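(* Let $M$ be a discrete maximal torus of the Weyl group $W=W(D_5)$. Then the discrete Weyl group $N_W(M)/M$ is isomorphic to the dihedral group of order $8$.
   Context: A discrete maximal torus of a finite Coxeter group $W$ is an Abelian subgroup of maximal order among Abelian subgroups of $W$ which, among such subgroups, has the largest number of cyclic factors of order $4$ in its decomposition into cyclic groups of prime-power order (for $W(D_5)$ this is a subgroup isomorphic to $\mathbb{Z}_4\times\mathbb{Z}_4$). The discrete Weyl group of $W$ is $W(M)=N_W(M)/M$, where $N_W(M)$ is the normalizer of $M$ in $W$. *)

theory Defs
  imports "HOL-Algebra.Algebra" "HOL-Computational_Algebra.Primes"
begin

text \<open>The Weyl group W(D_n) realised as the group of signed permutations of {1..n}
  with an even number of sign changes: bijections p of {-n..n} - {0} with p(-x) = -p(x)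
  such that the number of i in {1..n} with p(i) < 0 is even.  Group law is composition.\<close>
definition weyl_D :: "nat \<Rightarrow> (int \<Rightarrow> int) monoid" where
  "weyl_D n = \<lparr> carrier = {p. p permutes ({-int n..int n} - {0})
                             \<and> (\<forall>x. p (-x) = - p x)
                             \<and> even (card {i \<in> {1..int n}. p i < 0})},
               monoid.mult = (\<circ>), one = id \<rparr>"

definition abelian_subgroup :: "('a, 'b) monoid_scheme \<Rightarrow> 'a set \<Rightarrow> bool" where
  "abelian_subgroup G H \<longleftrightarrow> subgroup H G \<and> (\<forall>x\<in>H. \<forall>y\<in>H. x \<otimes>\<^bsub>G\<^esub> y = y \<otimes>\<^bsub>G\<^esub> x)"

definition max_order_abelian :: "('a, 'b) monoid_scheme \<Rightarrow> 'a set \<Rightarrow> bool" where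
  "max_order_abelian G M \<longleftrightarrow> abelian_subgroup G M \<and>
     (\<forall>K. abelian_subgroup G K \<longrightarrow> card K \<le> card M)"

definition Z4_factor_count :: "('a, 'b) monoid_scheme \<Rightarrow> 'a set \<Rightarrow> nat \<Rightarrow> bool" where
  "Z4_factor_count G H k \<longleftrightarrow>
     (\<exists>m (q :: nat \<Rightarrow> nat).
        (\<forall>i<m. \<exists>p e. Factorial_Ring.prime (p::nat) \<and> e \<ge> 1 \<and> q i = p ^ e) \<and>
        G\<lparr>carrier := H\<rparr> \<cong> product_group {..<m} (\<lambda>i. integer_mod_group (q i)) \<and>
        card {i. i < m \<and> q i = 4} = k)"

definition discrete_maximal_torus :: "('a, 'b) monoid_scheme \<Rightarrow> 'a set \<Rightarrow> bool" where
  "discrete_maximal_torus G M \<longleftrightarrow> max_order_abelian G M \<and>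
     (\<exists>k. Z4_factor_count G M k \<and>
        (\<forall>K k'. max_order_abelian G K \<and> Z4_factor_count G K k' \<longrightarrow> k' \<le> k))"

definition discrete_weyl_group :: "('a, 'b) monoid_scheme \<Rightarrow> 'a set \<Rightarrow> 'a set monoid" where
  "discrete_weyl_group G M = (G\<lparr>carrier := normalizer G M\<rparr>) Mod M"

text \<open>The dihedral group of order 8: symmetry group of a square, i.e. the automorphisms
  of the 4-cycle on vertices 0,1,2,3 (edges between i and i+1 mod 4).\<close>
definition square_adj :: "nat \<Rightarrow> nat \<Rightarrow> bool" where
  "square_adj i j \<longleftrightarrow> j = (i + 1) mod 4 \<or> i = (j + 1) mod 4"

definition dihedral8 :: "(nat \<Rightarrow> nat) monoid" where
  "dihedral8 = \<lparr> carrier = {p. p permutes {0..<4} \<and>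
                   (\<forall>i<4. \<forall>j<4. square_adj i j \<longleftrightarrow> square_adj (p i) (p j))},
                 monoid.mult = (\<circ>), one = id \<rparr>"

end

theory Submission
  imports Defs
begin

text \<open>
  Let \<open>K\<close> be an abelian subgroup of \<open>W(D\<^sub>n)\<close> with \<open>n\<close> odd. It acts on \<open>{1..n}\<close> by absolute
  values, and its elements are determined by their values at representatives of the orbits \<open>B\<close>,
  up to \<open>2 * card B\<close> choices each; evenness of the number of sign changes makes the sign on one
  odd orbit redundant. Since \<open>2 * k \<le> 2 ^ k\<close>, this gives \<open>2 * card K \<le> 2 ^ n\<close>, and equality
  forces all orbits to have at most two elements. For \<open>n = 5\<close> the bound 16 is attained by a group
  \<open>\<int>\<^sub>4 \<times> \<int>\<^sub>4\<close>, so a discrete maximal torus \<open>M\<close> has order 16 and contains two elements of order 4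
  with different squares. Hence there are two orbits of size 2, each with an element of \<open>M\<close> acting
  as a quarter turn, and \<open>M\<close> is conjugate to the centralizer of the two commuting quarter turns
  \<open>a\<close> and \<open>b\<close> in the planes 1, 2 and 3, 4 (both negating 5). The elements
  of \<open>M\<close> with nontrivial square that fix at least two of the coordinates are exactly
  \<open>a, b, a\<^sup>-\<^sup>1, b\<^sup>-\<^sup>1\<close>, so the normalizer acts on this
  set by conjugation. It preserves the pairs of mutually inverse elements, i.e. the diagonals of
  a square; the kernel is \<open>M\<close>, and all symmetries of the square occur.
\<close>

section \<open>Signed permutations\<close>

definition signed_perm :: "nat \<Rightarrow> (int \<Rightarrow> int) \<Rightarrow> bool" where
  "signed_perm n p \<longleftrightarrow> p permutes ({-int n..int n} - {0}) \<and> (\<forall>x. p (-x) = - p x)"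

definition neg_idx :: "nat \<Rightarrow> (int \<Rightarrow> int) \<Rightarrow> int set" where
  "neg_idx n p = {i \<in> {1..int n}. p i < 0}"

lemma finite_neg_idx [simp]: "finite (neg_idx n p)"
  unfolding neg_idx_def by (rule finite_subset[of _ "{1..int n}"]) auto

lemma signed_perm_minus: "signed_perm n p \<Longrightarrow> p (-x) = - p x"
  by (simp add: signed_perm_def)

lemma signed_perm_inj: "signed_perm n p \<Longrightarrow> inj p"
  by (auto simp: signed_perm_def dest: permutes_inj)

lemma signed_perm_eq_iff: "signed_perm n p \<Longrightarrow> p x = p y \<longleftrightarrow> x = y"
  by (auto dest: signed_perm_inj injD)

lemma signed_perm_eq_minus_iff: "signed_perm n p \<Longrightarrow> p x = - p y \<longleftrightarrow> x = - y"
  by (metis signed_perm_eq_iff signed_perm_minus)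

lemma signed_perm_abs: "signed_perm n p \<Longrightarrow> \<bar>p \<bar>x\<bar>\<bar> = \<bar>p x\<bar>"
  by (auto simp: abs_if signed_perm_minus)

lemma signed_perm_abs_eq_iff: "signed_perm n p \<Longrightarrow> \<bar>p x\<bar> = \<bar>p y\<bar> \<longleftrightarrow> \<bar>x\<bar> = \<bar>y\<bar>"
  by (auto simp: abs_eq_iff signed_perm_eq_iff signed_perm_eq_minus_iff)

lemma signed_perm_abs_in: "signed_perm n p \<Longrightarrow> \<bar>p x\<bar> \<in> {1..int n} \<longleftrightarrow> \<bar>x\<bar> \<in> {1..int n}"
proof -
  assume "signed_perm n p"
  then have "p x \<in> {-int n..int n} - {0} \<longleftrightarrow> x \<in> {-int n..int n} - {0}"
    by (metis permutes_in_image signed_perm_def)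
  then show ?thesis by auto
qed

lemma signed_perm_outside: "signed_perm n p \<Longrightarrow> \<bar>x\<bar> \<notin> {1..int n} \<Longrightarrow> p x = x"
  unfolding signed_perm_def by (rule permutes_not_in[of p "{-int n..int n} - {0}"]) auto

lemma signed_perm_ex: "signed_perm n p \<Longrightarrow> \<exists>x. p x = y"
  unfolding signed_perm_def by (metis permutes_surj surjD)

text \<open>On the finite set of nonzero integers of absolute value at most \<open>n\<close> an
  injective self-map is bijective. Injectivity on absolute values leaves only the possibility
  \<open>p y = p (- y)\<close>, which oddness turns into \<open>p y = 0\<close>, outside the
  range.\<close>

lemma signed_permI:
  assumes odd: "\<And>x. p (-x) = - p x"
    and into: "\<And>i. i \<in> {1..int n} \<Longrightarrow> \<bar>p i\<bar> \<in> {1..int n}"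
    and inj: "inj_on (\<lambda>i. \<bar>p i\<bar>) {1..int n}"
    and out: "\<And>x. \<bar>x\<bar> \<notin> {1..int n} \<Longrightarrow> p x = x"
  shows "signed_perm n p"
proof -
  let ?C = "{-int n..int n} - {0}"
  have C: "x \<in> ?C \<longleftrightarrow> \<bar>x\<bar> \<in> {1..int n}" for x by auto
  have abs: "\<bar>p \<bar>x\<bar>\<bar> = \<bar>p x\<bar>" for x by (auto simp: abs_if odd)
  have img: "p ` ?C \<subseteq> ?C"
  proof (rule image_subsetI)
    fix x assume that: "x \<in> ?C"
    show "p x \<in> ?C"
    using into[of "\<bar>x\<bar>"] that unfolding C abs by simp
  qed
  have inj': "inj_on p ?C"
  proof (rule inj_onI)
    fix x y assume xy: "x \<in> ?C" "y \<in> ?C" "p x = p y"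
    have "\<bar>p \<bar>x\<bar>\<bar> = \<bar>p \<bar>y\<bar>\<bar>" by (simp only: abs xy(3))
    moreover have "\<bar>x\<bar> \<in> {1..int n}" "\<bar>y\<bar> \<in> {1..int n}" using xy C by blast+
    ultimately have eq: "\<bar>x\<bar> = \<bar>y\<bar>" by (rule inj_onD[OF inj])
    have "x \<noteq> - y"
    proof
      assume "x = - y"
      with odd[of y] xy(3) have "p y = 0" by simp
      with into[of "\<bar>y\<bar>"] xy(2) abs[of y] show False unfolding C by simp
    qed
    with eq show "x = y" by (simp add: abs_eq_iff)
  qed
  have "bij_betw p ?C ?C"
    unfolding bij_betw_def using inj' endo_inj_surj[OF _ img inj'] by simp
  then have "p permutes ?C"
    by (rule bij_imp_permutes) (rule out, simp only: C not_False_eq_True)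
  then show ?thesis
    unfolding signed_perm_def using odd by simp
qed

lemma signed_perm_id: "signed_perm n id"
  by (auto simp: signed_perm_def permutes_id)

lemma signed_perm_comp: "signed_perm n p \<Longrightarrow> signed_perm n q \<Longrightarrow> signed_perm n (p \<circ> q)"
  by (auto simp: signed_perm_def intro: permutes_compose)

lemma signed_perm_inv:
  assumes "signed_perm n p" shows "signed_perm n (inv_into UNIV p)"
proof -
  have p: "p permutes ({-int n..int n} - {0})" using assms by (simp add: signed_perm_def)
  have "inv_into UNIV p (- x) = - inv_into UNIV p x" for x
  proof -
    have "p (- inv_into UNIV p x) = - x"
      by (simp add: signed_perm_minus[OF assms] permutes_inverses(1)[OF p])
    then show ?thesis using permutes_inverses(2)[OF p] by metis
  qed
  with p show ?thesis by (simp add: signed_perm_def permutes_inv)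
qed

text \<open>The sign changes of \<open>p \<circ> q\<close> are the symmetric difference of those of \<open>q\<close>
  and of those of \<open>p\<close> pulled back along \<open>|q|\<close>.\<close>
lemma even_neg_idx_comp:
  assumes p: "signed_perm n p" and q: "signed_perm n q"
  shows "even (card (neg_idx n (p \<circ> q))) \<longleftrightarrow> (even (card (neg_idx n p)) \<longleftrightarrow> even (card (neg_idx n q)))"
proof -
  let ?I = "{1..int n}"
  define A where "A = neg_idx n q"
  define B where "B = {i \<in> ?I. p \<bar>q i\<bar> < 0}"
  have fin: "finite A" "finite B" unfolding A_def B_def by (simp, rule finite_subset[of _ ?I]) auto
  have nz: "p x \<noteq> 0" if "\<bar>x\<bar> \<in> ?I" for x
    using signed_perm_abs_in[OF p, of x] that by auto
  have qI: "\<bar>q i\<bar> \<in> ?I" if "i \<in> ?I" for i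
    using signed_perm_abs_in[OF q, of i] that by auto
  have eq: "neg_idx n (p \<circ> q) = (A - B) \<union> (B - A)"
  proof (rule Set.set_eqI)
    fix i
    show "i \<in> neg_idx n (p \<circ> q) \<longleftrightarrow> i \<in> (A - B) \<union> (B - A)"
    proof (cases "i \<in> ?I")
      case True
      then show ?thesis
        using nz[OF qI[OF True]] signed_perm_minus[OF p, of "q i"] qI[OF True]
        by (auto simp: A_def B_def neg_idx_def abs_if)
    next
      case False
      then show ?thesis by (auto simp: A_def B_def neg_idx_def)
    qed
  qed
  have "card A + card B = card (A - B) + card (B - A) + 2 * card (A \<inter> B)"
  proof -
    have "card A = card (A - B) + card (A \<inter> B)" "card B = card (B - A) + card (A \<inter> B)"
      using fin by (metis card_Int_Diff add.commute, metis card_Int_Diff add.commute Int_commute)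
    then show ?thesis by simp
  qed
  moreover have "card (neg_idx n (p \<circ> q)) = card (A - B) + card (B - A)"
    unfolding eq using fin by (intro card_Un_disjoint) auto
  ultimately have "even (card (neg_idx n (p \<circ> q))) \<longleftrightarrow> even (card A + card B)" by simp
  \<comment> \<open>The map \<open>i \<mapsto> \<bar>q i\<bar>\<close> permutes
    \<open>{1..n}\<close> and carries \<open>B\<close> onto the positions where \<open>p\<close> is
    negative.\<close>
  moreover have "card B = card (neg_idx n p)"
  proof (rule bij_betw_same_card[of "\<lambda>i. \<bar>q i\<bar>"], rule bij_betw_imageI)
    show "inj_on (\<lambda>i. \<bar>q i\<bar>) B"
      by (auto simp: inj_on_def B_def signed_perm_abs_eq_iff[OF q])
    show "(\<lambda>i. \<bar>q i\<bar>) ` B = neg_idx n p"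
    proof (intro equalityI subsetI)
      fix j assume "j \<in> (\<lambda>i. \<bar>q i\<bar>) ` B"
      then show "j \<in> neg_idx n p" using qI by (auto simp: B_def neg_idx_def)
    next
      fix j assume j: "j \<in> neg_idx n p"
      obtain x where x: "q x = j" using signed_perm_ex[OF q] by blast
      have "\<bar>x\<bar> \<in> ?I" using signed_perm_abs_in[OF q, of x] j x by (auto simp: neg_idx_def)
      moreover have "\<bar>q \<bar>x\<bar>\<bar> = j" using signed_perm_abs[OF q, of x] j x by (auto simp: neg_idx_def)
      ultimately show "j \<in> (\<lambda>i. \<bar>q i\<bar>) ` B"
        using j by (intro image_eqI[of _ _ "\<bar>x\<bar>"]) (auto simp: B_def neg_idx_def)
    qed
  qed
  ultimately show ?thesis unfolding A_def even_add by auto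
qed

section \<open>The group W(D_n) and the parity constraint\<close>

lemma carrier_weyl_D:
  "p \<in> carrier (weyl_D n) \<longleftrightarrow> signed_perm n p \<and> even (card (neg_idx n p))"
  by (auto simp: weyl_D_def signed_perm_def neg_idx_def)

lemma carrier_weyl_D_signed_perm: "p \<in> carrier (weyl_D n) \<Longrightarrow> signed_perm n p"
  by (simp add: carrier_weyl_D)

lemma mult_weyl_D [simp]: "p \<otimes>\<^bsub>weyl_D n\<^esub> q = p \<circ> q"
  by (simp add: weyl_D_def)

lemma one_weyl_D [simp]: "\<one>\<^bsub>weyl_D n\<^esub> = id"
  by (simp add: weyl_D_def)

lemma inv_in_weyl_D:
  assumes "p \<in> carrier (weyl_D n)" shows "inv_into UNIV p \<in> carrier (weyl_D n)"
proof -
  have p: "signed_perm n p" using assms by (simp add: carrier_weyl_D)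
  have "p \<circ> inv_into UNIV p = id" using p by (metis signed_perm_def permutes_inv_o(1))
  moreover have "neg_idx n id = {}" by (auto simp: neg_idx_def)
  ultimately have "even (card (neg_idx n p)) \<longleftrightarrow> even (card (neg_idx n (inv_into UNIV p)))"
    using even_neg_idx_comp[OF p signed_perm_inv[OF p]] by simp
  with assms p show ?thesis by (simp add: carrier_weyl_D signed_perm_inv)
qed

lemma group_weyl_D: "group (weyl_D n)"
proof (rule groupI)
  fix p q assume "p \<in> carrier (weyl_D n)" "q \<in> carrier (weyl_D n)"
  then show "p \<otimes>\<^bsub>weyl_D n\<^esub> q \<in> carrier (weyl_D n)"
    by (auto simp: carrier_weyl_D signed_perm_comp even_neg_idx_comp)
next
  show "\<one>\<^bsub>weyl_D n\<^esub> \<in> carrier (weyl_D n)"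
  proof -
    have "neg_idx n id = {}" by (auto simp: neg_idx_def)
    then show ?thesis by (simp add: carrier_weyl_D signed_perm_id)
  qed
next
  fix p assume p: "p \<in> carrier (weyl_D n)"
  then have "inv_into UNIV p \<circ> p = id" by (metis carrier_weyl_D signed_perm_def permutes_inv_o(2))
  with inv_in_weyl_D[OF p] show "\<exists>q\<in>carrier (weyl_D n). q \<otimes>\<^bsub>weyl_D n\<^esub> p = \<one>\<^bsub>weyl_D n\<^esub>"
    by auto
qed (auto simp: comp_assoc)

lemma m_inv_weyl_D:
  assumes "p \<in> carrier (weyl_D n)" shows "inv\<^bsub>weyl_D n\<^esub> p = inv_into UNIV p"
proof -
  interpret group "weyl_D n" by (rule group_weyl_D)
  have "inv_into UNIV p \<circ> p = id" using assms by (metis carrier_weyl_D signed_perm_def permutes_inv_o(2))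
  then show ?thesis using inv_in_weyl_D[OF assms] assms by (intro inv_equality) auto
qed

lemma finite_carrier_weyl_D: "finite (carrier (weyl_D n))"
  by (rule finite_subset[OF _ finite_permutations[of "{-int n..int n} - {0}"]])
     (auto simp: weyl_D_def)

text \<open>At each point of \<open>S\<close> exactly one of \<open>p\<close> and \<open>q\<close>
  is negative, so their sign changes inside \<open>S\<close> add up to \<open>card S\<close>.
  Outside \<open>S\<close> they have the same sign changes, and both totals are even.\<close>

lemma even_disagreement:
  assumes p: "p \<in> carrier (weyl_D n)" and q: "q \<in> carrier (weyl_D n)"
    and S: "S \<subseteq> {1..int n}"
    and eq: "\<And>i. i \<in> {1..int n} - S \<Longrightarrow> p i = q i"
    and neq: "\<And>i. i \<in> S \<Longrightarrow> p i = - q i"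
  shows "even (card S)"
proof -
  have finS: "finite S" using S finite_subset by blast
  have nz: "q i \<noteq> 0" if "i \<in> {1..int n}" for i
    using signed_perm_abs_in[OF carrier_weyl_D_signed_perm[OF q], of i] that by auto
  define R where "R = neg_idx n p - S"
  have R: "R = neg_idx n q - S" unfolding R_def neg_idx_def using eq by auto
  have split: "card (neg_idx n f) = card (neg_idx n f \<inter> S) + card (neg_idx n f - S)" for f
    by (simp add: card_Int_Diff)
  have "neg_idx n p \<inter> S = S - (neg_idx n q \<inter> S)"
  proof (rule Set.set_eqI)
    fix i
    show "i \<in> neg_idx n p \<inter> S \<longleftrightarrow> i \<in> S - (neg_idx n q \<inter> S)"
    proof (cases "i \<in> S")
      case True
      then have "i \<in> {1..int n}" using S by blast
      then show ?thesis using True nz[of i] neq[of i] by (simp add: neg_idx_def linorder_not_less le_less)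
    qed simp
  qed
  then have "card S = card (neg_idx n p \<inter> S) + card (neg_idx n q \<inter> S)"
    using finS by (simp add: card_Diff_subset card_mono)
  moreover have "even (card (neg_idx n p \<inter> S) + card R)" "even (card (neg_idx n q \<inter> S) + card R)"
    using p q split[of p] split[of q] R by (auto simp: carrier_weyl_D R_def)
  ultimately show ?thesis by presburger
qed

text \<open>By bijectivity the values away from \<open>k\<close> determine \<open>p k\<close> up to
  sign. Opposite signs would make \<open>{k}\<close> a set of disagreement of odd size, against
  \<open>even_disagreement\<close>.\<close>

lemma weyl_D_eqI:
  assumes p: "p \<in> carrier (weyl_D n)" and q: "q \<in> carrier (weyl_D n)"
    and eq: "\<And>i. i \<in> {1..int n} \<Longrightarrow> i \<noteq> k \<Longrightarrow> p i = q i"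
  shows "p = q"
proof -
  note sp = carrier_weyl_D_signed_perm[OF p] and sq = carrier_weyl_D_signed_perm[OF q]
  have all: "p x = q x" if "\<bar>x\<bar> \<noteq> k" for x
  proof (cases "\<bar>x\<bar> \<in> {1..int n}")
    case True
    then have "p \<bar>x\<bar> = q \<bar>x\<bar>" using eq that by blast
    then show ?thesis
      by (cases "x < 0") (auto simp: signed_perm_minus[OF sp] signed_perm_minus[OF sq])
  next
    case False
    then show ?thesis using sp sq by (metis signed_perm_outside)
  qed
  have k: "p k = q k"
  proof (rule ccontr)
    assume neq: "p k \<noteq> q k"
    then have kI: "k \<in> {1..int n}"
      using all[of k] signed_perm_outside[OF sp, of k] signed_perm_outside[OF sq, of k]
      by (cases "k \<ge> 0") auto
    \<comment> \<open>If \<open>\<bar>y\<bar>\<close> were different from \<open>k\<close>, then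
      \<open>p y = q y = p k\<close> would contradict injectivity of \<open>p\<close>; so
      \<open>y\<close> is \<open>k\<close> or \<open>- k\<close>, and the first is excluded by
      \<open>neq\<close>.\<close>
    obtain y where y: "q y = p k" using signed_perm_ex[OF sq] by blast
    have "\<bar>y\<bar> = k"
    proof (rule ccontr)
      assume "\<bar>y\<bar> \<noteq> k"
      then have "p y = p k" using all y by simp
      then show False using \<open>\<bar>y\<bar> \<noteq> k\<close> kI by (simp add: signed_perm_eq_iff[OF sp])
    qed
    with y neq have "y = - k" by (auto simp: abs_if split: if_splits)
    with y have "p k = - q k" by (simp add: signed_perm_minus[OF sq])
    then have "even (card {k})"
      using kI eq by (intro even_disagreement[OF p q]) auto
    then show False by simp
  qed
  show ?thesis
  proof
    fix x
    consider "\<bar>x\<bar> \<noteq> k" | "x = k" | "x = - k" by linarith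
    then show "p x = q x"
      using all k by cases (simp_all add: signed_perm_minus[OF sp] signed_perm_minus[OF sq])
  qed
qed

section \<open>Orbits of abelian subgroups\<close>

locale abelian_weyl_D =
  fixes n :: nat and K :: "(int \<Rightarrow> int) set"
  assumes abelian: "abelian_subgroup (weyl_D n) K"
begin

lemma K_carrier: "p \<in> K \<Longrightarrow> p \<in> carrier (weyl_D n)"
  using abelian by (auto simp: abelian_subgroup_def dest: subgroup.mem_carrier)

lemma K_signed_perm: "p \<in> K \<Longrightarrow> signed_perm n p"
  by (simp add: K_carrier carrier_weyl_D_signed_perm)

lemma K_commute: "p \<in> K \<Longrightarrow> q \<in> K \<Longrightarrow> p (q x) = q (p x)"
  using abelian by (auto simp: abelian_subgroup_def fun_eq_iff)

lemma K_id: "id \<in> K"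
  using abelian subgroup.one_closed by (fastforce simp: abelian_subgroup_def)

lemma K_comp: "p \<in> K \<Longrightarrow> q \<in> K \<Longrightarrow> p \<circ> q \<in> K"
  using abelian subgroup.m_closed by (fastforce simp: abelian_subgroup_def)

lemma K_inv: "p \<in> K \<Longrightarrow> inv_into UNIV p \<in> K"
  using abelian subgroup.m_inv_closed[of K "weyl_D n" p]
  by (simp add: abelian_subgroup_def m_inv_weyl_D K_carrier)

lemma K_minus: "p \<in> K \<Longrightarrow> p (- x) = - p x"
  by (rule signed_perm_minus[OF K_signed_perm])

lemma finite_K: "finite K"
  using finite_carrier_weyl_D K_carrier by (meson finite_subset subsetI)

definition orb :: "int \<Rightarrow> int set" where
  "orb x = (\<lambda>p. \<bar>p x\<bar>) ` K"

lemma orb_self: "\<bar>x\<bar> \<in> orb x"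
  unfolding orb_def using K_id by (intro image_eqI[of _ _ id]) simp_all

lemma orb_eq:
  assumes "y \<in> orb x" shows "orb y = orb x"
proof -
  obtain p where p: "p \<in> K" "y = \<bar>p x\<bar>" using assms by (auto simp: orb_def)
  have *: "\<bar>q y\<bar> = \<bar>q (p x)\<bar>" if "q \<in> K" for q
    using signed_perm_abs[OF K_signed_perm[OF that]] p(2) by simp
  show ?thesis
  proof (intro equalityI subsetI)
    fix z assume "z \<in> orb y"
    then obtain q where q: "q \<in> K" "z = \<bar>q y\<bar>" by (auto simp: orb_def)
    then have "z = \<bar>(q \<circ> p) x\<bar>" by (simp add: *)
    then show "z \<in> orb x" unfolding orb_def using K_comp[OF q(1) p(1)] by (rule image_eqI)
  next
    fix z assume "z \<in> orb x"
    then obtain q where q: "q \<in> K" "z = \<bar>q x\<bar>" by (auto simp: orb_def)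
    have "inv_into UNIV p (p x) = x"
      using K_signed_perm[OF p(1)] signed_perm_inj inv_f_f by metis
    then have "z = \<bar>(q \<circ> inv_into UNIV p) y\<bar>"
      using *[OF K_comp[OF q(1) K_inv[OF p(1)]]] q(2) by simp
    then show "z \<in> orb y" unfolding orb_def using K_comp[OF q(1) K_inv[OF p(1)]] by (rule image_eqI)
  qed
qed

lemma orb_cases:
  assumes "\<bar>y\<bar> \<in> orb x"
  obtains t where "t \<in> K" "y = t x" | t where "t \<in> K" "y = - t x"
  using assms by (auto simp: orb_def abs_eq_iff)

text \<open>Every point of the orbit is \<open>t x\<close> or \<open>- t x\<close> with
  \<open>t\<close> in \<open>K\<close>, and \<open>p\<close> and \<open>q\<close> commute with
  \<open>t\<close>. This is where commutativity makes one value per orbit sufficient.\<close>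

lemma agree_on_orb:
  assumes "p \<in> K" "q \<in> K" "p x = q x" "\<bar>y\<bar> \<in> orb x"
  shows "p y = q y"
  using assms(4)
proof (cases rule: orb_cases)
  case (1 t) then show ?thesis using assms K_commute by metis
next
  case (2 t) then show ?thesis using assms K_commute K_minus by metis
qed

lemma opposite_on_orb:
  assumes "p \<in> K" "q \<in> K" "p x = - q x" "\<bar>y\<bar> \<in> orb x"
  shows "p y = - q y"
  using assms(4)
proof (cases rule: orb_cases)
  case (1 t) then show ?thesis using assms K_commute K_minus by metis
next
  case (2 t) then show ?thesis using assms K_commute K_minus by metis
qed

definition orbs :: "int set set" where
  "orbs = orb ` {1..int n}"

lemma orb_subset: "x \<in> {1..int n} \<Longrightarrow> orb x \<subseteq> {1..int n}"
proof
  fix y assume x: "x \<in> {1..int n}" and "y \<in> orb x"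
  then obtain p where "p \<in> K" "y = \<bar>p x\<bar>" by (auto simp: orb_def)
  then show "y \<in> {1..int n}" using signed_perm_abs_in[OF K_signed_perm, of p x] x by simp
qed

lemma orb_self': "x \<in> {1..int n} \<Longrightarrow> x \<in> orb x"
  using orb_self[of x] by simp

lemma Union_orbs: "\<Union> orbs = {1..int n}"
  unfolding orbs_def using orb_subset orb_self' by blast

lemma orbs_eq_orb: "B \<in> orbs \<Longrightarrow> x \<in> B \<Longrightarrow> B = orb x"
  unfolding orbs_def using orb_eq by blast

lemma finite_orbs: "finite orbs"
  by (simp add: orbs_def)

lemma finite_orb: "B \<in> orbs \<Longrightarrow> finite B"
  using finite_K by (auto simp: orbs_def orb_def)

lemma orbs_nonempty: "B \<in> orbs \<Longrightarrow> B \<noteq> {}"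
  using K_id by (auto simp: orbs_def orb_def)

lemma orbs_some: "B \<in> orbs \<Longrightarrow> (SOME x. x \<in> B) \<in> B"
  using orbs_nonempty by (simp add: some_in_eq)

lemma sum_card_orbs: "(\<Sum>B\<in>orbs. card B) = n"
proof -
  have "card (\<Union> orbs) = sum card orbs"
  proof (rule card_Union_disjoint)
    show "pairwise disjnt orbs"
      unfolding pairwise_def disjnt_iff using orbs_eq_orb by metis
  qed (rule finite_orb)
  then show ?thesis by (simp add: Union_orbs)
qed

text \<open>An element of \<open>K\<close> is determined by its values on orbit representatives, and the
  evenness of the number of sign changes allows one to forget the sign of the value on an odd orbit.\<close>
lemma card_le_prod_orbs:
  assumes "odd n"
  shows "2 * card K \<le> (\<Prod>B\<in>orbs. 2 * card B)"
proof -
  \<comment> \<open>The orbit sizes add up to the odd number \<open>n\<close>.\<close>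
  have "\<exists>B\<in>orbs. odd (card B)"
  proof (rule ccontr)
    assume "\<not> ?thesis"
    then have "even (\<Sum>B\<in>orbs. card B)" by (intro dvd_sum) auto
    with assms show False by (simp add: sum_card_orbs)
  qed
  then obtain B0 where B0: "B0 \<in> orbs" "odd (card B0)" by blast
  define rep where "rep B = (SOME x::int. x \<in> B)" for B
  have rep: "rep B \<in> B" "orb (rep B) = B" if "B \<in> orbs" for B
    using orbs_some[OF that] orbs_eq_orb[OF that] unfolding rep_def by blast+
  \<comment> \<open>\<open>T B\<close> collects the possible values at the representative of
    \<open>B\<close>. On the odd orbit \<open>B0\<close> only the absolute value is recorded, which
    saves the factor 2 on the left of the claim.\<close>
  define T where "T B = (if B = B0 then B else B \<union> uminus ` B)" for B :: "int set"
  define F where "F p = (\<lambda>B\<in>orbs. if B = B0 then \<bar>p (rep B)\<bar> else p (rep B))" for p :: "int \<Rightarrow> int"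
  have F_in: "F p \<in> PiE orbs T" if p: "p \<in> K" for p
  proof (rule PiE_I)
    fix B assume B: "B \<in> orbs"
    have "\<bar>p (rep B)\<bar> \<in> orb (rep B)" using p by (simp add: orb_def)
    then have *: "\<bar>p (rep B)\<bar> \<in> B" unfolding rep(2)[OF B] .
    then have "p (rep B) \<in> B \<union> uminus ` B"
      by (cases "p (rep B) \<ge> 0") (auto intro: image_eqI[of _ _ "- p (rep B)"])
    with * show "F p B \<in> T B" using B by (cases "B = B0") (simp_all add: F_def T_def)
  qed (simp add: F_def)
  have F_inj: "inj_on F K"
  proof (rule inj_onI)
    fix p q assume p: "p \<in> K" and q: "q \<in> K" and eq: "F p = F q"
    have other: "p i = q i" if "i \<in> {1..int n} - B0" for i
    proof -
      have "i \<in> \<Union> orbs" unfolding Union_orbs using that by (rule DiffD1)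
      then obtain B where B: "B \<in> orbs" "i \<in> B" by (rule UnionE)
      then have "B \<noteq> B0" using that by blast
      then have "p (rep B) = q (rep B)"
        using fun_cong[OF eq, of B] B(1) by (simp add: F_def)
      moreover have "\<bar>i\<bar> \<in> orb (rep B)" using B(2) rep(2)[OF B(1)] that by simp
      ultimately show ?thesis by (rule agree_on_orb[OF p q])
    qed
    have B0_sub: "B0 \<subseteq> {1..int n}" using B0 Union_orbs by blast
    have B0_orb: "\<bar>i\<bar> \<in> orb (rep B0)" if "i \<in> B0" for i
    proof -
      have "1 \<le> i" using subsetD[OF B0_sub that] by simp
      then show ?thesis using that rep(2)[OF B0(1)] by simp
    qed
    have "\<bar>p (rep B0)\<bar> = \<bar>q (rep B0)\<bar>"
      using fun_cong[OF eq, of B0] B0(1) by (simp add: F_def)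
    then consider "p (rep B0) = q (rep B0)" | "p (rep B0) = - q (rep B0)"
      by (auto simp: abs_eq_iff)
    then show "p = q"
    proof cases
      case 1
      have "p i = q i" if "i \<in> {1..int n}" for i
        using that other[of i] agree_on_orb[OF p q 1 B0_orb[of i]] by (cases "i \<in> B0") simp_all
      then show ?thesis by (intro weyl_D_eqI[OF K_carrier[OF p] K_carrier[OF q]])
    next
      case 2
      \<comment> \<open>If the signs at the representative differ, then \<open>p\<close> and
        \<open>q\<close> are opposite on all of \<open>B0\<close> and equal elsewhere, so
        \<open>B0\<close> would have even size.\<close>
      have "even (card B0)"
        using even_disagreement[OF K_carrier[OF p] K_carrier[OF q] B0_sub other]
          opposite_on_orb[OF p q 2 B0_orb] by blast
      with B0 show ?thesis by simp
    qed
  qed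
  have finT: "finite (T B)" if "B \<in> orbs" for B
    using finite_orb[OF that] by (cases "B = B0") (simp_all add: T_def)
  have "card K \<le> card (PiE orbs T)"
    using F_in by (intro card_inj_on_le[OF F_inj] finite_PiE finite_orbs finT) blast+
  also have "\<dots> = (\<Prod>B\<in>orbs. card (T B))" by (rule card_PiE[OF finite_orbs])
  also have "\<dots> = card B0 * (\<Prod>B\<in>orbs - {B0}. card (T B))"
    using finite_orbs B0 by (simp add: prod.remove T_def)
  also have "\<dots> \<le> card B0 * (\<Prod>B\<in>orbs - {B0}. 2 * card B)"
  proof (intro mult_left_mono prod_mono conjI)
    fix B assume "B \<in> orbs - {B0}"
    then have "card (T B) \<le> card B + card (uminus ` B)" by (simp add: T_def card_Un_le)
    also have "\<dots> \<le> 2 * card B"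
      using card_image_le[OF finite_orb, of B uminus] \<open>B \<in> orbs - {B0}\<close> by simp
    finally show "card (T B) \<le> 2 * card B" .
  qed auto
  finally have "2 * card K \<le> 2 * card B0 * (\<Prod>B\<in>orbs - {B0}. 2 * card B)" by simp
  also have "\<dots> = (\<Prod>B\<in>orbs. 2 * card B)"
    using finite_orbs B0 by (simp add: prod.remove)
  finally show ?thesis .
qed

end

section \<open>The order bound and its equality case\<close>

lemma double_less_power2: "3 \<le> k \<Longrightarrow> 2 * k < 2 ^ k"
  by (induction k rule: dec_induct) auto

lemma double_le_power2: "2 * k \<le> 2 ^ k" for k :: nat
proof (cases "3 \<le> k")
  case False
  then have "k = 0 \<or> k = 1 \<or> k = 2" by linarith
  then show ?thesis by auto
qed (simp add: double_less_power2 less_imp_le)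

context abelian_weyl_D
begin

lemma prod_power2_orbs: "(\<Prod>B\<in>orbs. 2 ^ card B) = (2 ^ n :: nat)"
  by (simp add: power_sum[symmetric] sum_card_orbs)

lemma card_le_power2:
  assumes "odd n" shows "2 * card K \<le> 2 ^ n"
proof -
  have "(\<Prod>B\<in>orbs. 2 * card B) \<le> (\<Prod>B\<in>orbs. 2 ^ card B)"
    by (intro prod_mono) (simp add: double_le_power2)
  with card_le_prod_orbs[OF assms] show ?thesis by (simp add: prod_power2_orbs)
qed

text \<open>An orbit with at least three points contributes a factor \<open>2 * card B\<close>
  strictly below \<open>2 ^ card B\<close>. The remaining factors are positive and do not exceed the
  corresponding powers, so the bound on \<open>card K\<close> would be strict.\<close>

lemma card_orb_le_2:
  assumes "odd n" "2 * card K = 2 ^ n" "B \<in> orbs"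
  shows "card B \<le> 2"
proof (rule ccontr)
  assume "\<not> ?thesis"
  then have "2 * card B < 2 ^ card B" by (simp add: double_less_power2)
  moreover have "(\<Prod>B\<in>orbs - {B}. 2 * card B) \<le> (\<Prod>B\<in>orbs - {B}. 2 ^ card B)"
    by (intro prod_mono) (simp add: double_le_power2)
  moreover have "0 < (\<Prod>B\<in>orbs - {B}. 2 ^ card B :: nat)" by (simp add: prod_pos)
  moreover have "0 < (\<Prod>B\<in>orbs - {B}. 2 * card B)"
    using orbs_nonempty finite_orb by (intro prod_pos) (simp add: card_gt_0_iff)
  ultimately have "2 * card B * (\<Prod>B\<in>orbs - {B}. 2 * card B)
      < 2 ^ card B * (\<Prod>B\<in>orbs - {B}. 2 ^ card B)"
    by (intro mult_less_le_imp_less) auto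
  then have "(\<Prod>B\<in>orbs. 2 * card B) < (\<Prod>B\<in>orbs. 2 ^ card B)"
    using finite_orbs assms(3) by (simp add: prod.remove)
  then show False
    using card_le_prod_orbs[OF assms(1)] assms(2) by (simp add: prod_power2_orbs)
qed

section \<open>Quarter turns in subgroups with orbits of at most two points\<close>

lemma square_eq_or_minus:
  assumes le: "\<forall>B\<in>orbs. card B \<le> 2" and p: "p \<in> K"
  shows "p (p x) = x \<or> p (p x) = - x"
proof (cases "\<bar>x\<bar> \<in> {1..int n}")
  case True
  note sp = K_signed_perm[OF p]
  have B: "orb \<bar>x\<bar> \<in> orbs" using True by (simp add: orbs_def)
  have abs_orb: "\<bar>q x\<bar> \<in> orb \<bar>x\<bar>" if "q \<in> K" for q
    unfolding orb_def using that signed_perm_abs[OF K_signed_perm[OF that], of x]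
    by (intro image_eqI[of _ _ q]) simp_all
  \<comment> \<open>Two of these three points of a single orbit coincide. Since \<open>p\<close> is
    injective on absolute values, every coincidence leads to
    \<open>\<bar>p (p x)\<bar> = \<bar>x\<bar>\<close>.\<close>
  have sub: "{\<bar>x\<bar>, \<bar>p x\<bar>, \<bar>p (p x)\<bar>} \<subseteq> orb \<bar>x\<bar>"
    using abs_orb[OF K_id] abs_orb[OF p] abs_orb[OF K_comp[OF p p]] by simp
  have "\<not> distinct [\<bar>x\<bar>, \<bar>p x\<bar>, \<bar>p (p x)\<bar>]"
  proof
    assume "distinct [\<bar>x\<bar>, \<bar>p x\<bar>, \<bar>p (p x)\<bar>]"
    then have "card {\<bar>x\<bar>, \<bar>p x\<bar>, \<bar>p (p x)\<bar>} = 3" by simp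
    then show False using card_mono[OF finite_orb[OF B] sub] bspec[OF le B] by simp
  qed
  then have "\<bar>p x\<bar> = \<bar>x\<bar> \<or> \<bar>p (p x)\<bar> = \<bar>x\<bar>"
    using signed_perm_abs_eq_iff[OF sp, of "p x" x] by auto
  then have "\<bar>p (p x)\<bar> = \<bar>x\<bar>"
    using signed_perm_abs_eq_iff[OF sp, of "p x" x] by auto
  then show ?thesis by (simp add: abs_eq_iff)
next
  case False
  then show ?thesis using signed_perm_outside[OF K_signed_perm[OF p]] by simp
qed

text \<open>Squares take each \<open>x\<close> to \<open>x\<close> or \<open>- x\<close>, so where
  the squares of \<open>p\<close> and \<open>q\<close> differ, one of them negates \<open>x\<close>
  and the other fixes it. The latter is \<open>h\<close>: its square is trivial on the whole orbit
  of \<open>x\<close> but not everywhere, so it negates some \<open>y\<close> in another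
  orbit.\<close>

lemma rotated_in_distinct_orbits:
  assumes le: "\<forall>B\<in>orbs. card B \<le> 2" and p: "p \<in> K" and q: "q \<in> K"
    and "p \<circ> p \<noteq> id" "q \<circ> q \<noteq> id" "p \<circ> p \<noteq> q \<circ> q"
  obtains f h x y where "f \<in> K" "h \<in> K" "f (f x) = - x" "h (h y) = - y" "x \<noteq> 0" "y \<noteq> 0"
    "\<bar>y\<bar> \<notin> orb x"
proof -
  note result = that
  have *: thesis if f: "f \<in> K" and h: "h \<in> K" and "f (f x) \<noteq> x" "h (h x) = x" "h (h y) \<noteq> y" for f h x y
  proof (rule result[OF f h])
    show "f (f x) = - x" "h (h y) = - y"
      using square_eq_or_minus[OF le f, of x] square_eq_or_minus[OF le h, of y] \<open>f (f x) \<noteq> x\<close> \<open>h (h y) \<noteq> y\<close>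
      by auto
    then show "x \<noteq> 0" "y \<noteq> 0" using \<open>f (f x) \<noteq> x\<close> \<open>h (h y) \<noteq> y\<close> by auto
    show "\<bar>y\<bar> \<notin> orb x"
    proof
      assume "\<bar>y\<bar> \<in> orb x"
      then have "(h \<circ> h) y = id y"
        using agree_on_orb[OF K_comp[OF h h] K_id, of x y] \<open>h (h x) = x\<close> by simp
      with \<open>h (h y) \<noteq> y\<close> show False by simp
    qed
  qed
  obtain x where x: "p (p x) \<noteq> q (q x)" using assms(6) by (auto simp: fun_eq_iff)
  obtain y where y: "p (p y) \<noteq> y" using assms(4) by (auto simp: fun_eq_iff)
  obtain y' where y': "q (q y') \<noteq> y'" using assms(5) by (auto simp: fun_eq_iff)
  show thesis
  proof (cases "p (p x) = x")
    case True
    with x have "q (q x) \<noteq> x" by simp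
    from *[OF q p this True y] show thesis .
  next
    case False
    then have "p (p x) = - x" using square_eq_or_minus[OF le p, of x] by simp
    with x have "q (q x) = x" using square_eq_or_minus[OF le q, of x] by auto
    from *[OF p q False this y'] show thesis .
  qed
qed

lemma orb_abs: "orb \<bar>x\<bar> = orb x"
  using orb_eq[OF orb_self] .

lemma orb_in_orbs: "\<bar>x\<bar> \<in> {1..int n} \<Longrightarrow> orb x \<in> orbs"
  unfolding orbs_def using orb_abs[of x] by blast

text \<open>If \<open>f x\<close> were \<open>x\<close> or \<open>- x\<close>, then
  \<open>f (f x)\<close> would be \<open>x\<close>. So \<open>\<bar>x\<bar>\<close> and
  \<open>\<bar>f x\<bar>\<close> are two different points of the orbit and exhaust it.\<close>

lemma orb_pairI:
  assumes le: "\<forall>B\<in>orbs. card B \<le> 2" and f: "f \<in> K" "f (f x) = - x" "x \<noteq> 0"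
  shows "\<bar>x\<bar> \<in> {1..int n}" "\<bar>f x\<bar> \<in> {1..int n}" "\<bar>f x\<bar> \<noteq> \<bar>x\<bar>" "orb x = {\<bar>x\<bar>, \<bar>f x\<bar>}"
proof -
  note sf = K_signed_perm[OF f(1)]
  have ne: "f x \<noteq> x" "f x \<noteq> - x"
    using f K_minus[OF f(1), of x] by auto
  then show abs: "\<bar>f x\<bar> \<noteq> \<bar>x\<bar>" by (simp add: abs_eq_iff)
  show x: "\<bar>x\<bar> \<in> {1..int n}" using signed_perm_outside[OF sf, of x] ne by blast
  then show "\<bar>f x\<bar> \<in> {1..int n}" using signed_perm_abs_in[OF sf] by blast
  have "{\<bar>x\<bar>, \<bar>f x\<bar>} \<subseteq> orb x" using orb_self f(1) by (auto simp: orb_def)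
  moreover have "card (orb x) \<le> card {\<bar>x\<bar>, \<bar>f x\<bar>}"
    using bspec[OF le orb_in_orbs[OF x]] abs by simp
  ultimately show "orb x = {\<bar>x\<bar>, \<bar>f x\<bar>}"
    using finite_orb[OF orb_in_orbs[OF x]] by (metis card_seteq)
qed

end

section \<open>Dihedral normalizer quotients\<close>

lemma carrier_dihedral8:
  "p \<in> carrier dihedral8 \<longleftrightarrow> p permutes {0..<4} \<and>
     (\<forall>i<4. \<forall>j<4. square_adj i j \<longleftrightarrow> square_adj (p i) (p j))"
  by (simp add: dihedral8_def)

lemma mult_dihedral8 [simp]: "p \<otimes>\<^bsub>dihedral8\<^esub> q = p \<circ> q"
  by (simp add: dihedral8_def)

lemma one_dihedral8 [simp]: "\<one>\<^bsub>dihedral8\<^esub> = id"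
  by (simp add: dihedral8_def)

lemma group_dihedral8: "group dihedral8"
proof (rule groupI)
  fix p q assume p: "p \<in> carrier dihedral8" and q: "q \<in> carrier dihedral8"
  have "q i < 4" if "i < 4" for i
    using q that permutes_in_image[of q "{0..<4}" i] by (simp add: carrier_dihedral8)
  with p q show "p \<otimes>\<^bsub>dihedral8\<^esub> q \<in> carrier dihedral8"
    by (simp add: carrier_dihedral8 permutes_compose)
next
  fix p assume p: "p \<in> carrier dihedral8"
  then have perm: "p permutes {0..<4}" by (simp add: carrier_dihedral8)
  let ?q = "inv_into UNIV p"
  have "?q i < 4" if "i < 4" for i
    using that permutes_in_image[OF permutes_inv[OF perm], of i] by simp
  with p have "?q \<in> carrier dihedral8"
    by (simp add: carrier_dihedral8 permutes_inv permutes_inverses(1)[OF perm])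
  then show "\<exists>q\<in>carrier dihedral8. q \<otimes>\<^bsub>dihedral8\<^esub> p = \<one>\<^bsub>dihedral8\<^esub>"
    using permutes_inv_o(2)[OF perm] by auto
qed (auto simp: carrier_dihedral8 permutes_id comp_assoc)

lemma less_4_cases: "i < 4 \<Longrightarrow> i = 0 \<or> i = 1 \<or> i = 2 \<or> i = (3::nat)"
  by linarith

text \<open>Opposite vertices are exactly the distinct nonadjacent ones, so a symmetry preserves
  diagonals and its values at 0 and 1 determine those at 2 and 3.\<close>

lemma dihedral8_eqI:
  assumes p: "p \<in> carrier dihedral8" and q: "q \<in> carrier dihedral8"
    and eq: "p 0 = q 0" "p 1 = q 1"
  shows "p = q"
proof -
  have pp: "p permutes {0..<4}" and qp: "q permutes {0..<4}"
    using p q by (simp_all add: carrier_dihedral8)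
  have opp: "f j = (f i + 2) mod 4" if f: "f \<in> carrier dihedral8" and i: "i < 2" and j: "j = i + 2" for f i j
  proof -
    have perm: "f permutes {0..<4}" using f by (simp add: carrier_dihedral8)
    have "f i < 4" "f j < 4"
      using permutes_in_image[OF perm, of i] permutes_in_image[OF perm, of j] i j by simp_all
    moreover have "f i \<noteq> f j" using permutes_inj[OF perm] using j by (simp add: inj_eq)
    moreover have "\<not> square_adj i j" using i j by (auto simp: square_adj_def less_2_cases_iff)
    then have "\<not> square_adj (f i) (f j)" using f i j by (simp add: carrier_dihedral8)
    ultimately show ?thesis
      by (auto simp: square_adj_def dest!: less_4_cases)
  qed
  show ?thesis
  proof
    fix i :: nat
    consider "i = 0" | "i = 1" | "i = 2" | "i = 3" | "i \<ge> 4" by linarith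
    then show "p i = q i"
    proof cases
      case 3 then show ?thesis using opp[OF p, of 0 i] opp[OF q, of 0 i] eq by simp
    next
      case 4 then show ?thesis using opp[OF p, of 1 i] opp[OF q, of 1 i] eq by simp
    next
      case 5 then show ?thesis using permutes_not_in[OF pp, of i] permutes_not_in[OF qp, of i] by simp
    qed (use eq in auto)
  qed
qed


section \<open>Conjugation of two elements and their inverses by a normalizer\<close>

lemma (in group) mem_normalizer_iff:
  assumes "M \<subseteq> carrier G"
  shows "g \<in> normalizer G M \<longleftrightarrow> g \<in> carrier G \<and> (\<lambda>x. g \<otimes> x \<otimes> inv g) ` M = M"
proof -
  have "g <# M #> inv g = (\<lambda>x. g \<otimes> x \<otimes> inv g) ` M"
    by (auto simp: l_coset_def r_coset_def)
  with assms show ?thesis by (simp add: normalizer_def stabilizer_def)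
qed

text \<open>The four elements \<open>a, b, inv a, inv b\<close> serve as consecutive vertices of a
  square on which the normalizer acts by conjugation. The kernel is the common centralizer
  \<open>M\<close> of \<open>a\<close> and \<open>b\<close>; \<open>r\<close> induces a rotation by
  one vertex and \<open>s\<close> a reflection in a diagonal, and these generate all
  symmetries.\<close>

lemma (in group) normalizer_quotient_dihedral8:
  assumes a: "a \<in> carrier G" and b: "b \<in> carrier G"
    and dist: "distinct [a, b, inv a, inv b]"
    and M: "M = {x \<in> carrier G. x \<otimes> a = a \<otimes> x \<and> x \<otimes> b = b \<otimes> x}"
    and T: "\<And>g z. g \<in> normalizer G M \<Longrightarrow> z \<in> {a, b, inv a, inv b} \<Longrightarrow>
              g \<otimes> z \<otimes> inv g \<in> {a, b, inv a, inv b}"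
    and r: "r \<in> carrier G" "r \<otimes> a = b \<otimes> r" "r \<otimes> b = inv a \<otimes> r"
    and s: "s \<in> carrier G" "s \<otimes> a = a \<otimes> s" "s \<otimes> b = inv b \<otimes> s"
  shows "discrete_weyl_group G M \<cong> dihedral8"
proof -
  define N where "N = normalizer G M"
  define c where "c g x = g \<otimes> x \<otimes> inv g" for g x
  define v where "v i = [a, b, inv a, inv b] ! i" for i
  have M_sub: "M \<subseteq> carrier G" using M by blast
  have subN: "subgroup N G" unfolding N_def by (rule normalizer_imp_subgroup[OF M_sub])
  have N_carr: "g \<in> carrier G" if "g \<in> N" for g using subN that by (rule subgroup.mem_carrier)
  have c_closed [simp]: "c g x \<in> carrier G" if "g \<in> carrier G" "x \<in> carrier G" for g x
    using that by (simp add: c_def)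
  have c_mult: "c g (x \<otimes> y) = c g x \<otimes> c g y" if "g \<in> carrier G" "x \<in> carrier G" "y \<in> carrier G" for g x y
    using that by (simp add: c_def m_assoc inv_solve_left)
  have c_inv: "c g (inv x) = inv (c g x)" if "g \<in> carrier G" "x \<in> carrier G" for g x
    using that by (simp add: c_def inv_mult_group m_assoc)
  have c_comp: "c (g \<otimes> h) x = c g (c h x)" if "g \<in> carrier G" "h \<in> carrier G" "x \<in> carrier G" for g h x
    using that by (simp add: c_def inv_mult_group m_assoc)
  have c_eq_iff: "c g x = c g y \<longleftrightarrow> x = y" if "g \<in> carrier G" "x \<in> carrier G" "y \<in> carrier G" for g x y
    using that by (simp add: c_def)
  have c_eqI: "c g x = y" if "g \<otimes> x = y \<otimes> g" "g \<in> carrier G" "x \<in> carrier G" "y \<in> carrier G" for g x y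
    using that by (simp add: c_def m_assoc)
  have v_simps: "v 0 = a" "v 1 = b" "v 2 = inv a" "v 3 = inv b"
    by (simp_all add: v_def numeral_eq_Suc)
  have v_carr [simp]: "v i \<in> carrier G" if "i < 4" for i
    using less_4_cases[OF that] a b v_simps by auto
  have v_image: "v ` {0..<4} = {a, b, inv a, inv b}"
  proof -
    have "{0..<4} = {0, 1, 2, 3::nat}" by auto
    then show ?thesis by (simp only: v_simps image_insert image_empty)
  qed
  have v_inj: "v i = v j \<longleftrightarrow> i = j" if "i < 4" "j < 4" for i j
    unfolding v_def using that by (intro nth_eq_iff_index_eq[OF dist]) simp_all
  \<comment> \<open>Vertices are adjacent when they are neither equal nor inverse to each other, a
    condition that conjugation preserves.\<close>
  have v_adj: "square_adj i j \<longleftrightarrow> v i \<noteq> v j \<and> v j \<noteq> inv (v i)" if "i < 4" "j < 4" for i j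
  proof -
    have ii: "inv (v i) = v ((i + 2) mod 4)"
      using less_4_cases[OF that(1)]
      by (elim disjE) (simp_all add: v_simps a b v_def)
    have "square_adj i j \<longleftrightarrow> i \<noteq> j \<and> j \<noteq> (i + 2) mod 4"
      using less_4_cases[OF that(1)] less_4_cases[OF that(2)]
      by (elim disjE) (simp_all add: square_adj_def)
    then show ?thesis unfolding ii using that v_inj by simp
  qed

  \<comment> \<open>\<open>\<phi> g\<close> is the permutation of vertex indices induced by
    conjugation with \<open>g\<close>, extended by the identity beyond index 3 as
    \<open>permutes\<close> requires.\<close>
  define \<phi> where "\<phi> g i = (if i < 4 then THE j. j < 4 \<and> v j = c g (v i) else i)" for g and i :: nat
  have \<phi>_eq: "\<phi> g i = j" if "i < 4" "j < 4" "v j = c g (v i)" for g i j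
  proof -
    have "(THE j. j < 4 \<and> v j = c g (v i)) = j"
    proof (rule the_equality)
      fix k assume "k < 4 \<and> v k = c g (v i)"
      then show "k = j" using that v_inj[of k j] by simp
    qed (use that in simp)
    then show ?thesis using that by (simp add: \<phi>_def)
  qed
  have \<phi>: "\<phi> g i < 4" "v (\<phi> g i) = c g (v i)" if g: "g \<in> N" and i: "i < 4" for g i
  proof -
    have "v i \<in> {a, b, inv a, inv b}" using i v_image by force
    then have "c g (v i) \<in> v ` {0..<4}"
      unfolding v_image c_def using T g by (simp add: N_def)
    then obtain j where "j < 4" "v j = c g (v i)" by force
    then show "\<phi> g i < 4" "v (\<phi> g i) = c g (v i)" using \<phi>_eq[OF i] by auto
  qed
  have \<phi>_out: "\<phi> g i = i" if "\<not> i < 4" for g i using that by (simp add: \<phi>_def)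
  have \<phi>_dihedral: "\<phi> g \<in> carrier dihedral8" if g: "g \<in> N" for g
  proof -
    have "inj_on (\<phi> g) {0..<4}"
    proof (rule inj_onI)
      fix i j assume ij: "i \<in> {0..<4}" "j \<in> {0..<4}" "\<phi> g i = \<phi> g j"
      then have "c g (v i) = c g (v j)" using \<phi>(2)[OF g] by (metis atLeastLessThan_iff)
      then show "i = j" using ij c_eq_iff[OF N_carr[OF g]] v_inj by simp
    qed
    moreover have "\<phi> g ` {0..<4} \<subseteq> {0..<4}" using \<phi>(1)[OF g] by auto
    ultimately have "bij_betw (\<phi> g) {0..<4} {0..<4}"
      using endo_inj_surj[of "{0..<4}" "\<phi> g"] by (simp add: bij_betw_def)
    then have "\<phi> g permutes {0..<4}"
      by (rule bij_imp_permutes) (simp add: \<phi>_out)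
    moreover have "square_adj i j \<longleftrightarrow> square_adj (\<phi> g i) (\<phi> g j)" if "i < 4" "j < 4" for i j
      using that \<phi>[OF g] c_eq_iff[OF N_carr[OF g]]
      by (simp add: v_adj c_inv[OF N_carr[OF g], symmetric])
    ultimately show ?thesis by (simp add: carrier_dihedral8)
  qed
  have \<phi>_mult: "\<phi> (g \<otimes> h) = \<phi> g \<circ> \<phi> h" if g: "g \<in> N" and h: "h \<in> N" for g h
  proof
    fix i
    show "\<phi> (g \<otimes> h) i = (\<phi> g \<circ> \<phi> h) i"
    proof (cases "i < 4")
      case True
      then have "v (\<phi> g (\<phi> h i)) = c (g \<otimes> h) (v i)"
        using \<phi>[OF g] \<phi>[OF h] c_comp N_carr g h by simp
      with True show ?thesis using \<phi>_eq \<phi>[OF g] \<phi>[OF h] by simp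
    qed (simp add: \<phi>_out)
  qed

  \<comment> \<open>All four vertices commute with \<open>M\<close>. Preimages \<open>x\<close> and
    \<open>y\<close> of \<open>a\<close> and \<open>b\<close> among them show that conjugation by
    \<open>g\<close> maps \<open>M\<close> into \<open>M\<close>; the images of \<open>a\<close> and
    \<open>b\<close> among them give the same for the inverse of \<open>g\<close>.\<close>
  have N_I: "g \<in> N" if g: "g \<in> carrier G" and ga: "c g a \<in> v ` {0..<4}" and gb: "c g b \<in> v ` {0..<4}"
    and x: "x \<in> v ` {0..<4}" "c g x = a" and y: "y \<in> v ` {0..<4}" "c g y = b" for g x y
  proof -
    have comm_inv: "z \<otimes> inv u = inv u \<otimes> z"
      if "z \<in> carrier G" "u \<in> carrier G" "z \<otimes> u = u \<otimes> z" for z u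
      using that by (metis inv_closed inv_solve_left inv_solve_right m_assoc m_closed)
    have comm: "z \<otimes> t = t \<otimes> z" if "z \<in> M" "t \<in> v ` {0..<4}" for z t
      using that a b comm_inv unfolding v_image M by auto
    have t_carr: "t \<in> carrier G" if "t \<in> v ` {0..<4}" for t using that by auto
    have "c g z \<in> M" if z: "z \<in> M" for z
    proof -
      have zc: "z \<in> carrier G" using z M_sub by blast
      have "c g z \<otimes> c g t = c g t \<otimes> c g z" if "t \<in> v ` {0..<4}" for t
        using comm[OF z that] c_mult[OF g] zc t_carr[OF that] by metis
      from this[OF x(1)] this[OF y(1)] show ?thesis
        unfolding M using g zc x(2) y(2) by simp
    qed
    moreover have "z \<in> c g ` M" if z: "z \<in> M" for z
    proof -
      have zc: "z \<in> carrier G" using z M_sub by blast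
      let ?w = "inv g \<otimes> z \<otimes> g"
      have w: "?w \<in> carrier G" using g zc by simp
      have cw: "c g ?w = z" 
      proof -
        have "c g ?w = (g \<otimes> inv g) \<otimes> z \<otimes> (g \<otimes> inv g)"
          unfolding c_def using g zc by (simp only: m_assoc m_closed inv_closed)
        then show ?thesis using g zc by simp
      qed
      have "?w \<otimes> t = t \<otimes> ?w" if t: "t \<in> carrier G" "c g t \<in> v ` {0..<4}" for t
      proof -
        have "c g (?w \<otimes> t) = c g (t \<otimes> ?w)"
          using comm[OF z t(2)] c_mult[OF g] cw w t(1) by simp
        then show ?thesis using c_eq_iff[OF g] w t(1) by simp
      qed
      then have "?w \<in> M" unfolding M using w a b ga gb by blast
      with cw show ?thesis by (metis image_eqI)
    qed
    ultimately have "c g ` M = M" by blast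
    then show ?thesis unfolding N_def mem_normalizer_iff[OF M_sub] c_def using g by simp
  qed
  have T_mem: "a \<in> v ` {0..<4}" "b \<in> v ` {0..<4}" "inv a \<in> v ` {0..<4}" "inv b \<in> v ` {0..<4}"
    unfolding v_image by simp_all

  have cr: "c r a = b" "c r b = inv a" using c_eqI r a b by simp_all
  have cr': "c r (inv b) = a" "c r (inv a) = inv b" using c_inv r(1) a b cr by simp_all
  have rN: "r \<in> N" by (rule N_I[OF r(1) _ _ T_mem(4) cr'(1) T_mem(1) cr(1)]) (simp_all only: cr T_mem)
  have cs: "c s a = a" "c s b = inv b" using c_eqI s a b by simp_all
  have cs': "c s (inv b) = b" using c_inv s(1) b cs by simp
  have sN: "s \<in> N" by (rule N_I[OF s(1) _ _ T_mem(1) cs(1) T_mem(4) cs']) (simp_all only: cs T_mem)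
  have c_M: "c g a = a" "c g b = b" if "g \<in> M" for g
    using that a b by (simp_all add: M c_eqI)
  have M_N: "g \<in> N" if g: "g \<in> M" for g
    by (rule N_I[OF _ _ _ T_mem(1) c_M(1)[OF g] T_mem(2) c_M(2)[OF g]])
       (use g M_sub in blast, simp_all only: c_M[OF g] T_mem)

  let ?GN = "G\<lparr>carrier := N\<rparr>"
  interpret D: group dihedral8 by (rule group_dihedral8)
  interpret GN: group ?GN by (rule subgroup_imp_group[OF subN])
  interpret \<phi>: group_hom ?GN dihedral8 \<phi>
    by unfold_locales (auto simp: hom_def \<phi>_dihedral \<phi>_mult)
  have "kernel ?GN dihedral8 \<phi> = M"
  proof (intro equalityI subsetI)
    fix g assume "g \<in> kernel ?GN dihedral8 \<phi>"
    then have g: "g \<in> N" "\<phi> g = id" by (auto simp: kernel_def)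
    then have "c g a = a" "c g b = b"
      using \<phi>(2)[OF g(1), of 0] \<phi>(2)[OF g(1), of 1] v_simps by simp_all
    then show "g \<in> M" unfolding M
      using N_carr[OF g(1)] a b by (simp add: c_def inv_solve_right')
  next
    fix g assume g: "g \<in> M"
    then have gN: "g \<in> N" by (rule M_N)
    have "\<phi> g = id"
      by (rule dihedral8_eqI[OF \<phi>_dihedral[OF gN]])
         (use D.one_closed \<phi>_eq[of 0 0 g] \<phi>_eq[of 1 1 g] c_M[OF g] v_simps in auto)
    with gN show "g \<in> kernel ?GN dihedral8 \<phi>" by (simp add: kernel_def)
  qed
  moreover have "\<phi> ` carrier ?GN = carrier dihedral8"
  proof (intro equalityI subsetI)
    fix p assume p: "p \<in> carrier dihedral8"
    have r_val: "\<phi> r 0 = 1" "\<phi> r 1 = 2" "\<phi> r 2 = 3" "\<phi> r 3 = 0"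
      using \<phi>_eq[of _ _ r] cr cr' v_simps by simp_all
    have s_val: "\<phi> s 0 = 0" "\<phi> s 1 = 3"
      using \<phi>_eq[of _ _ s] cs v_simps by simp_all
    have one_val: "\<phi> \<one> = id" using \<phi>.hom_one by simp
    have hit: "p \<in> \<phi> ` N" if "g \<in> N" "\<phi> g 0 = p 0" "\<phi> g 1 = p 1" for g
      using dihedral8_eqI[OF \<phi>_dihedral[OF that(1)] p] that by blast
    have mN: "g \<otimes> h \<in> N" if "g \<in> N" "h \<in> N" for g h
      using subN that by (rule subgroup.m_closed)
    have oneN: "\<one> \<in> N" using subN by (rule subgroup.one_closed)
    have "p 0 < 4" "p 1 < 4"
      using p permutes_in_image[of p "{0..<4}"] by (auto simp: carrier_dihedral8)
    moreover have "square_adj 0 1" by (simp add: square_adj_def)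
    then have "square_adj (p 0) (p 1)" using p by (simp add: carrier_dihedral8)
    \<comment> \<open>An image of vertex 0 and an adjacent image of vertex 1 leave eight cases. The
      first four are the powers of \<open>r\<close>, the last four their products with
      \<open>s\<close>.\<close>
    ultimately consider "p 0 = 0" "p 1 = 1" | "p 0 = 1" "p 1 = 2" | "p 0 = 2" "p 1 = 3" | "p 0 = 3" "p 1 = 0"
      | "p 0 = 0" "p 1 = 3" | "p 0 = 1" "p 1 = 0" | "p 0 = 2" "p 1 = 1" | "p 0 = 3" "p 1 = 2"
      by (auto simp: square_adj_def dest!: less_4_cases)
    then have "p \<in> \<phi> ` N"
    proof cases
      case 1 show ?thesis by (rule hit[OF oneN]) (simp_all add: one_val 1 del: One_nat_def)
    next
      case 2 show ?thesis by (rule hit[OF rN]) (simp_all add: r_val 2 del: One_nat_def)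
    next
      case 3 show ?thesis by (rule hit[of "r \<otimes> r"]) (simp_all add: mN rN \<phi>_mult r_val 3 del: One_nat_def)
    next
      case 4 show ?thesis by (rule hit[of "r \<otimes> (r \<otimes> r)"]) (simp_all add: mN rN \<phi>_mult r_val 4 del: One_nat_def)
    next
      case 5 show ?thesis by (rule hit[OF sN]) (simp_all add: s_val 5 del: One_nat_def)
    next
      case 6 show ?thesis by (rule hit[of "r \<otimes> s"]) (simp_all add: mN rN sN \<phi>_mult r_val s_val 6 del: One_nat_def)
    next
      case 7 show ?thesis by (rule hit[of "r \<otimes> (r \<otimes> s)"]) (simp_all add: mN rN sN \<phi>_mult r_val s_val 7 del: One_nat_def)
    next
      case 8 show ?thesis by (rule hit[of "r \<otimes> (r \<otimes> (r \<otimes> s))"]) (simp_all add: mN rN sN \<phi>_mult r_val s_val 8 del: One_nat_def)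
    qed
    then show "p \<in> \<phi> ` carrier ?GN" by simp
  qed (use \<phi>_dihedral in auto)
  ultimately show ?thesis
    using \<phi>.FactGroup_iso unfolding discrete_weyl_group_def N_def by simp
qed

text \<open>Conjugation by \<open>k\<close> moves the model pair \<open>a, b\<close> to
  \<open>a', b'\<close>, so all computations can be done with the model. As the vertices lie in
  \<open>M\<close>, their conjugates by normalizer elements stay in \<open>M\<close>; this is why
  \<open>T\<close> speaks only of conjugates that commute with \<open>a\<close> and
  \<open>b\<close>.\<close>

lemma (in group) normalizer_quotient_dihedral8_conj:
  assumes a: "a \<in> carrier G" and b: "b \<in> carrier G" and ab: "a \<otimes> b = b \<otimes> a"
    and dist: "distinct [a, b, inv a, inv b]"
    and T: "\<And>g z. g \<in> carrier G \<Longrightarrow> z \<in> {a, b, inv a, inv b} \<Longrightarrow>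
              g \<otimes> z \<otimes> inv g \<otimes> a = a \<otimes> (g \<otimes> z \<otimes> inv g) \<Longrightarrow>
              g \<otimes> z \<otimes> inv g \<otimes> b = b \<otimes> (g \<otimes> z \<otimes> inv g) \<Longrightarrow>
              g \<otimes> z \<otimes> inv g \<in> {a, b, inv a, inv b}"
    and r: "r \<in> carrier G" "r \<otimes> a = b \<otimes> r" "r \<otimes> b = inv a \<otimes> r"
    and s: "s \<in> carrier G" "s \<otimes> a = a \<otimes> s" "s \<otimes> b = inv b \<otimes> s"
    and k: "k \<in> carrier G" "a' \<otimes> k = k \<otimes> a" "b' \<otimes> k = k \<otimes> b" "a' \<in> carrier G" "b' \<in> carrier G"
    and M: "M = {x \<in> carrier G. x \<otimes> a' = a' \<otimes> x \<and> x \<otimes> b' = b' \<otimes> x}"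
  shows "discrete_weyl_group G M \<cong> dihedral8"
proof -
  define c where "c x = k \<otimes> x \<otimes> inv k" for x
  have c_closed [simp]: "c x \<in> carrier G" if "x \<in> carrier G" for x
    using that k by (simp add: c_def)
  have c_mult': "c (x \<otimes> y) = c x \<otimes> c y" if "x \<in> carrier G" "y \<in> carrier G" for x y
    using that k(1) by (simp add: c_def m_assoc inv_solve_left)
  note c_mult = c_mult'[symmetric]
  have c_inv: "inv (c x) = c (inv x)" if "x \<in> carrier G" for x
    using that k by (simp add: c_def inv_mult_group m_assoc)
  have c_eq_iff: "c x = c y \<longleftrightarrow> x = y" if "x \<in> carrier G" "y \<in> carrier G" for x y
    using that k by (simp add: c_def)
  have c_surj: "\<exists>y\<in>carrier G. x = c y" if x: "x \<in> carrier G" for x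
  proof
    have "c (inv k \<otimes> x \<otimes> k) = (k \<otimes> inv k) \<otimes> x \<otimes> (k \<otimes> inv k)"
      unfolding c_def using k(1) x by (simp only: m_assoc m_closed inv_closed)
    then show "x = c (inv k \<otimes> x \<otimes> k)" using k(1) x by simp
  qed (use k x in simp)
  have a': "a' = c a" and b': "b' = c b"
    using k a b by (simp_all add: c_def inv_solve_right)
  have inv_ab: "inv a \<in> carrier G" "inv b \<in> carrier G" using a b by simp_all
  have comm_inv: "z \<otimes> inv u = inv u \<otimes> z"
    if "z \<in> carrier G" "u \<in> carrier G" "z \<otimes> u = u \<otimes> z" for z u
    using that by (metis inv_closed inv_solve_left inv_solve_right m_assoc m_closed)
  have T_M: "c ` {a, b, inv a, inv b} \<subseteq> M"
    unfolding M a' b' using a b inv_ab ab comm_inv[OF a b] comm_inv[OF b a] comm_inv[OF a a] comm_inv[OF b b]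
    by (auto simp: c_mult)
  have M_sub: "M \<subseteq> carrier G" using M by blast
  show ?thesis
  proof (rule normalizer_quotient_dihedral8[of a' b'])
    show "distinct [a', b', inv a', inv b']"
      using dist a b by (simp add: a' b' c_inv c_eq_iff)
    fix g z assume g: "g \<in> normalizer G M" and z: "z \<in> {a', b', inv a', inv b'}"
    then have gc: "g \<in> carrier G" and gM: "(\<lambda>x. g \<otimes> x \<otimes> inv g) ` M = M"
      by (simp_all add: mem_normalizer_iff[OF M_sub])
    obtain g0 where g0: "g0 \<in> carrier G" "g = c g0" using c_surj[OF gc] by blast
    obtain z0 where z0: "z0 \<in> {a, b, inv a, inv b}" "z = c z0"
      using z by (auto simp: a' b' c_inv a b)
    have z0c: "z0 \<in> carrier G" using z0 a b by auto
    have "z \<in> M" using T_M z0 by blast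
    then have "g \<otimes> z \<otimes> inv g \<in> M" using gM by blast
    moreover have eq: "g \<otimes> z \<otimes> inv g = c (g0 \<otimes> z0 \<otimes> inv g0)"
      using g0 z0c by (simp add: z0(2) c_mult c_inv)
    ultimately have "g0 \<otimes> z0 \<otimes> inv g0 \<otimes> a = a \<otimes> (g0 \<otimes> z0 \<otimes> inv g0)"
      "g0 \<otimes> z0 \<otimes> inv g0 \<otimes> b = b \<otimes> (g0 \<otimes> z0 \<otimes> inv g0)"
      using g0 z0c a b by (auto simp: M a' b' c_mult c_eq_iff)
    from T[OF g0(1) z0(1) this] show "g \<otimes> z \<otimes> inv g \<in> {a', b', inv a', inv b'}"
      unfolding eq a' b' using a b by (auto simp: c_inv)
  next
    show "c r \<otimes> a' = b' \<otimes> c r" "c r \<otimes> b' = inv a' \<otimes> c r" "c s \<otimes> a' = a' \<otimes> c s" "c s \<otimes> b' = inv b' \<otimes> c s"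
      using r s a b by (simp_all add: a' b' c_mult c_inv)
  qed (use k r s M in simp_all)
qed

section \<open>Groups with two cyclic factors of order 4\<close>

text \<open>The generators of two different factors of order 4 have nontrivial squares supported in
  different coordinates.\<close>

lemma Z4_factor_count_2_imp_squares:
  assumes "group G" "subgroup M G" "Z4_factor_count G M k" "2 \<le> k"
  obtains a b where "a \<in> M" "b \<in> M" "a \<otimes>\<^bsub>G\<^esub> a \<noteq> \<one>\<^bsub>G\<^esub>" "b \<otimes>\<^bsub>G\<^esub> b \<noteq> \<one>\<^bsub>G\<^esub>"
    "a \<otimes>\<^bsub>G\<^esub> a \<noteq> b \<otimes>\<^bsub>G\<^esub> b"
proof -
  obtain m and q :: "nat \<Rightarrow> nat" where
    q: "\<And>i. i < m \<Longrightarrow> \<exists>p e. Factorial_Ring.prime (p::nat) \<and> e \<ge> 1 \<and> q i = p ^ e"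
    and iso: "G\<lparr>carrier := M\<rparr> \<cong> product_group {..<m} (\<lambda>i. integer_mod_group (q i))"
    and card: "card {i. i < m \<and> q i = 4} = k"
    using assms(3) unfolding Z4_factor_count_def by blast
  let ?P = "product_group {..<m} (\<lambda>i. integer_mod_group (q i))"
  obtain h where h: "h \<in> iso (G\<lparr>carrier := M\<rparr>) ?P"
    using iso by (auto simp: is_iso_def)
  have P: "group ?P" by (rule product_group) simp
  have GM: "group (G\<lparr>carrier := M\<rparr>)"
    using group.subgroup_imp_group[OF assms(1,2)] .
  interpret h: group_hom "G\<lparr>carrier := M\<rparr>" ?P h
    using h GM P by (simp add: group_hom_def group_hom_axioms_def iso_def)
  have "\<exists>i j. i \<noteq> j \<and> i \<in> {i. i < m \<and> q i = 4} \<and> j \<in> {i. i < m \<and> q i = 4}"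
  proof (rule ccontr)
    assume "\<not> ?thesis"
    then have "card {i. i < m \<and> q i = 4} \<le> Suc 0" by (intro card_le_Suc0_iff_eq[THEN iffD2]) auto
    with card assms(4) show False by simp
  qed
  then obtain i j where ij: "i \<noteq> j" "i < m" "q i = 4" "j < m" "q j = 4" by auto
  \<comment> \<open>\<open>u i\<close> is the unit vector of coordinate \<open>i\<close>; when
    \<open>q i = 4\<close> its square has entry 2 there and 0 elsewhere.\<close>
  define u where "u i = (\<lambda>l\<in>{..<m}. if l = i then 1 else (0::int))" for i
  have u: "u i \<in> carrier ?P" if "q i = 4" for i
    using that by (auto simp: u_def carrier_integer_mod_group)
  have uu: "(u i \<otimes>\<^bsub>?P\<^esub> u i) l = (if l = i then 2 else 0)" if "q i = 4" "l < m" for i l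
    using that by (simp add: u_def)
  have img: "h ` M = carrier ?P" using h by (auto simp: iso_def bij_betw_def)
  obtain a where a: "a \<in> M" "h a = u i" using img u[OF ij(3)] by (metis imageE)
  obtain b where b: "b \<in> M" "h b = u j" using img u[OF ij(5)] by (metis imageE)
  have haa: "h (a \<otimes>\<^bsub>G\<^esub> a) = u i \<otimes>\<^bsub>?P\<^esub> u i" using h.hom_mult[of a a] a by simp
  have hbb: "h (b \<otimes>\<^bsub>G\<^esub> b) = u j \<otimes>\<^bsub>?P\<^esub> u j" using h.hom_mult[of b b] b by simp
  have h1: "h \<one>\<^bsub>G\<^esub> i = 0" "h \<one>\<^bsub>G\<^esub> j = 0" using h.hom_one ij by simp_all
  show ?thesis
  proof (rule that[OF a(1) b(1)])
    show "a \<otimes>\<^bsub>G\<^esub> a \<noteq> \<one>\<^bsub>G\<^esub>" using uu[OF ij(3,2)] haa h1(1) by (metis zero_neq_numeral)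
    show "b \<otimes>\<^bsub>G\<^esub> b \<noteq> \<one>\<^bsub>G\<^esub>" using uu[OF ij(5,4)] hbb h1(2) by (metis zero_neq_numeral)
    show "a \<otimes>\<^bsub>G\<^esub> a \<noteq> b \<otimes>\<^bsub>G\<^esub> b" 
      using uu[OF ij(3,2)] uu[OF ij(5,2)] ij(1) haa hbb by (metis zero_neq_numeral)
  qed
qed

text \<open>The map sending \<open>(i, j)\<close> to \<open>a [^] i \<otimes> b [^] j\<close> is a
  homomorphism on pairs of residues modulo 4, and \<open>triv\<close> says that its kernel is
  trivial. \<open>K\<close> is its image.\<close>

lemma (in group) Z4_times_Z4:
  assumes a: "a \<in> carrier G" and b: "b \<in> carrier G" and ab: "a \<otimes> b = b \<otimes> a"
    and a4: "a [^] (4::int) = \<one>" and b4: "b [^] (4::int) = \<one>"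
    and triv: "\<And>i j. i \<in> {0..<4} \<Longrightarrow> j \<in> {0..<4} \<Longrightarrow> a [^] (i::int) \<otimes> b [^] (j::int) = \<one> \<Longrightarrow> i = 0 \<and> j = 0"
  obtains K where "abelian_subgroup G K" "Z4_factor_count G K 2" "card K = 16"
proof -
  let ?P = "product_group {..<2::nat} (\<lambda>i. integer_mod_group 4)"
  define h where "h f = a [^] (f 0 :: int) \<otimes> b [^] (f 1 :: int)" for f :: "nat \<Rightarrow> int"
  have pow_mod: "x [^] (k mod 4) = x [^] k" if "x \<in> carrier G" "x [^] (4::int) = \<one>" for x and k :: int
  proof -
    have "x [^] k = x [^] (4 * (k div 4) + k mod 4)" by simp
    also have "\<dots> = (x [^] (4::int)) [^] (k div 4) \<otimes> x [^] (k mod 4)"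
      using that(1) by (simp only: int_pow_mult int_pow_pow)
    finally show ?thesis using that by simp
  qed
  \<comment> \<open>Integer exponents are traded for natural ones because
    \<open>group_commutes_pow\<close> concerns natural exponents.\<close>
  have pow_nat: "x [^] k = x [^] nat (k mod 4)" if "x \<in> carrier G" "x [^] (4::int) = \<one>" for x and k :: int
    using pow_mod[OF that, of k] int_pow_int[of G x "nat (k mod 4)"] by simp
  have comm': "a [^] (k::int) \<otimes> b [^] (l::int) = b [^] l \<otimes> a [^] k" for k l
  proof -
    have "a [^] n \<otimes> b = b \<otimes> a [^] n" for n :: nat
      using a b ab by (simp add: group_commutes_pow)
    then have "b [^] m \<otimes> a [^] n = a [^] n \<otimes> b [^] m" for m n :: nat
      using a b by (simp add: group_commutes_pow)
    then show ?thesis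
      unfolding pow_nat[OF a a4, of k] pow_nat[OF b b4, of l] by metis
  qed
  have P: "group ?P" by (rule product_group) simp
  have hom: "h \<in> hom ?P G"
  proof (rule homI)
    fix f g assume "f \<in> carrier ?P" "g \<in> carrier ?P"
    have "h (f \<otimes>\<^bsub>?P\<^esub> g) = a [^] ((f 0 + g 0) mod 4) \<otimes> b [^] ((f 1 + g 1) mod 4)"
      by (simp add: h_def)
    also have "\<dots> = (a [^] f 0 \<otimes> a [^] g 0) \<otimes> (b [^] f 1 \<otimes> b [^] g 1)"
      using a b a4 b4 by (simp add: pow_mod int_pow_mult)
    also have "\<dots> = a [^] f 0 \<otimes> (a [^] g 0 \<otimes> b [^] f 1) \<otimes> b [^] g 1"
      using a b by (simp add: m_assoc)
    also have "\<dots> = h f \<otimes> h g"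
      using a b unfolding comm'[of "g 0" "f 1"] h_def by (simp add: m_assoc)
    finally show "h (f \<otimes>\<^bsub>?P\<^esub> g) = h f \<otimes> h g" .
  qed (simp add: h_def a b)
  interpret h: group_hom ?P G h
    using P hom by (simp add: group_hom_def group_hom_axioms_def is_group)
  have inj: "inj_on h (carrier ?P)"
  proof -
    have "f = \<one>\<^bsub>?P\<^esub>" if f: "f \<in> carrier ?P" and "h f = \<one>" for f
    proof (rule PiE_ext[of f "{..<2}" "\<lambda>_. carrier (integer_mod_group 4)"])
      fix i :: nat assume "i \<in> {..<2}"
      have "f 0 \<in> {0..<4}" "f 1 \<in> {0..<4}"
        using f PiE_mem[of f "{..<2}" "\<lambda>_. carrier (integer_mod_group 4)"]
        by (simp_all add: carrier_integer_mod_group)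
      with triv[of "f 0" "f 1"] that(2) have "f 0 = 0" "f 1 = 0" unfolding h_def by blast+
      then show "f i = \<one>\<^bsub>?P\<^esub> i" using \<open>i \<in> {..<2}\<close> by (auto simp: less_2_cases_iff)
    qed (use f in auto)
    then show ?thesis unfolding h.inj_on_one_iff by blast
  qed
  define K where "K = h ` carrier ?P"
  have sub: "subgroup K G" unfolding K_def by (rule h.img_is_subgroup)
  have "h \<in> iso ?P (G\<lparr>carrier := K\<rparr>)"
    using hom inj by (auto simp: iso_def hom_def K_def bij_betw_def)
  then have "G\<lparr>carrier := K\<rparr> \<cong> ?P" using group.iso_sym[OF P] by (auto simp: is_iso_def)
  moreover have "\<exists>p e. Factorial_Ring.prime (p::nat) \<and> e \<ge> 1 \<and> 4 = p ^ e"
    by (intro exI[of _ 2]) simp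
  ultimately have "Z4_factor_count G K 2"
    unfolding Z4_factor_count_def by (intro exI[of _ 2] exI[of _ "\<lambda>_. 4"]) simp
  moreover have "card K = 16"
  proof -
    have "card (carrier ?P) = 16" by (simp add: card_PiE carrier_integer_mod_group)
    then show ?thesis unfolding K_def card_image[OF inj] .
  qed
  moreover have "abelian_subgroup G K"
    unfolding abelian_subgroup_def
  proof (intro conjI sub ballI)
    fix x y assume "x \<in> K" "y \<in> K"
    then obtain f g where "f \<in> carrier ?P" "x = h f" "g \<in> carrier ?P" "y = h g"
      by (auto simp: K_def)
    moreover have "f \<otimes>\<^bsub>?P\<^esub> g = g \<otimes>\<^bsub>?P\<^esub> f" by (simp add: add.commute)
    ultimately show "x \<otimes> y = y \<otimes> x" using h.hom_mult by metis
  qed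
  ultimately show ?thesis using that by blast
qed

section \<open>The torus in \<open>W(D\<^sub>5)\<close>\<close>

text \<open>This is the window notation of a signed permutation: the list gives the images of 1, 2,
  ..., extended oddly to negative arguments and by the identity elsewhere.\<close>

definition signed_list :: "int list \<Rightarrow> int \<Rightarrow> int" where
  "signed_list l x = (if \<bar>x\<bar> \<in> {1..int (length l)} then sgn x * l ! nat (\<bar>x\<bar> - 1) else x)"

lemma signed_list_in_weyl_D:
  assumes "length l = n" "distinct (map abs l)" "abs ` set l \<subseteq> {1..int n}"
    and "even (length (filter (\<lambda>y. y < 0) l))"
  shows "signed_list l \<in> carrier (weyl_D n)"
proof -
  have pos: "signed_list l i = l ! nat (i - 1)" if "i \<in> {1..int n}" for i
    using that assms(1) by (simp add: signed_list_def)
  have "signed_perm n (signed_list l)"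
  proof (rule signed_permI)
    show "signed_list l (- x) = - signed_list l x" for x
      by (simp add: signed_list_def sgn_minus)
    show "\<bar>signed_list l i\<bar> \<in> {1..int n}" if "i \<in> {1..int n}" for i
    proof -
      have "l ! nat (i - 1) \<in> set l" using that assms(1) by (intro nth_mem) auto
      then show ?thesis unfolding pos[OF that] using assms(3) by blast
    qed
    show "inj_on (\<lambda>i. \<bar>signed_list l i\<bar>) {1..int n}"
    proof (rule inj_onI)
      fix i j assume ij: "i \<in> {1..int n}" "j \<in> {1..int n}" and "\<bar>signed_list l i\<bar> = \<bar>signed_list l j\<bar>"
      moreover have len: "nat (i - 1) < length (map abs l)" "nat (j - 1) < length (map abs l)"
        using ij assms(1) by auto
      ultimately have "map abs l ! nat (i - 1) = map abs l ! nat (j - 1)"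
        by (simp add: pos)
      moreover note len
      ultimately have "nat (i - 1) = nat (j - 1)" using nth_eq_iff_index_eq[OF assms(2)] by blast
      with ij show "i = j" by (auto simp: eq_nat_nat_iff)
    qed
    show "signed_list l x = x" if "\<bar>x\<bar> \<notin> {1..int n}" for x
      using that assms(1) by (simp only: signed_list_def if_False)
  qed
  moreover have "card (neg_idx n (signed_list l)) = length (filter (\<lambda>y. y < 0) l)"
  proof -
    have "neg_idx n (signed_list l) = (\<lambda>j. int j + 1) ` {j. j < length l \<and> l ! j < 0}"
    proof (intro equalityI subsetI)
      fix i assume "i \<in> neg_idx n (signed_list l)"
      then have "i \<in> {1..int n}" "l ! nat (i - 1) < 0" using pos by (auto simp: neg_idx_def)
      then show "i \<in> (\<lambda>j. int j + 1) ` {j. j < length l \<and> l ! j < 0}"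
        using assms(1) by (intro image_eqI[of _ _ "nat (i - 1)"]) auto
    next
      fix i assume "i \<in> (\<lambda>j. int j + 1) ` {j. j < length l \<and> l ! j < 0}"
      then obtain j where j: "i = int j + 1" "j < length l" "l ! j < 0" by blast
      then have "i \<in> {1..int n}" using assms(1) by simp
      moreover from this have "signed_list l i < 0" using pos[of i] j by simp
      ultimately show "i \<in> neg_idx n (signed_list l)" by (simp add: neg_idx_def)
    qed
    then show ?thesis
      by (simp add: card_image inj_on_def length_filter_conv_card)
  qed
  ultimately show ?thesis using assms(4) by (simp add: carrier_weyl_D)
qed

abbreviation "W5 \<equiv> carrier (weyl_D 5)"

text \<open>\<open>std_a\<close> and \<open>std_b\<close> are the quarter turns in the planes 1, 2
  and 3, 4, and the primed versions are their inverses. \<open>std_r\<close> carries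
  \<open>std_a\<close> to \<open>std_b\<close> and \<open>std_b\<close> to the inverse of
  \<open>std_a\<close>; \<open>std_s\<close> reflects the plane 3, 4 and so inverts
  \<open>std_b\<close>. The entry -5 makes the number of sign changes even in each case.\<close>

definition std_a where "std_a = signed_list [2, -1, 3, 4, -5]"
definition std_a' where "std_a' = signed_list [-2, 1, 3, 4, -5]"
definition std_b where "std_b = signed_list [1, 2, 4, -3, -5]"
definition std_b' where "std_b' = signed_list [1, 2, -4, 3, -5]"
definition std_r where "std_r = signed_list [3, 4, 1, -2, -5]"
definition std_s where "std_s = signed_list [1, 2, 3, -4, -5]"

lemmas std_defs = std_a_def std_a'_def std_b_def std_b'_def std_r_def std_s_def

lemma std_in_W [simp]: "std_a \<in> W5" "std_a' \<in> W5" "std_b \<in> W5" "std_b' \<in> W5" "std_r \<in> W5" "std_s \<in> W5"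
  unfolding std_defs by (rule signed_list_in_weyl_D; simp)+

lemma std_simps [simp]:
  "std_a 1 = 2" "std_a 2 = -1" "std_a 3 = 3" "std_a 4 = 4" "std_a 5 = -5"
  "std_a' 1 = -2" "std_a' 2 = 1" "std_a' 3 = 3" "std_a' 4 = 4" "std_a' 5 = -5"
  "std_b 1 = 1" "std_b 2 = 2" "std_b 3 = 4" "std_b 4 = -3" "std_b 5 = -5"
  "std_b' 1 = 1" "std_b' 2 = 2" "std_b' 3 = -4" "std_b' 4 = 3" "std_b' 5 = -5"
  "std_r 1 = 3" "std_r 2 = 4" "std_r 3 = 1" "std_r 4 = -2" "std_r 5 = -5"
  "std_s 1 = 1" "std_s 2 = 2" "std_s 3 = 3" "std_s 4 = -4" "std_s 5 = -5"
  by (simp_all add: std_defs signed_list_def)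

lemma W5_minus: "p \<in> W5 \<Longrightarrow> p (- x) = - p x"
  by (rule signed_perm_minus[OF carrier_weyl_D_signed_perm])

lemma std_minus [simp]:
  "std_a (- x) = - std_a x" "std_a' (- x) = - std_a' x" "std_b (- x) = - std_b x"
  "std_b' (- x) = - std_b' x" "std_r (- x) = - std_r x" "std_s (- x) = - std_s x"
  by (simp_all add: W5_minus)

lemma W5_comp: "p \<in> W5 \<Longrightarrow> q \<in> W5 \<Longrightarrow> p \<circ> q \<in> W5"
  using monoid.m_closed[OF group.is_monoid[OF group_weyl_D], of p 5 q] by simp

lemma W5_id: "id \<in> W5"
  using monoid.one_closed[OF group.is_monoid[OF group_weyl_D], of 5] by simp

lemma W5_eqI:
  assumes "p \<in> W5" "q \<in> W5" "p 1 = q 1" "p 2 = q 2" "p 3 = q 3" "p 4 = q 4"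
  shows "p = q"
proof (rule weyl_D_eqI[OF assms(1,2), of 5])
  fix i :: int assume "i \<in> {1..int 5}" "i \<noteq> 5"
  then have "i = 1 \<or> i = 2 \<or> i = 3 \<or> i = 4" by auto
  then show "p i = q i" using assms by auto
qed

section \<open>Relations, centralizer and conjugates of the standard quarter turns\<close>

lemma std_relations:
  "std_a' \<circ> std_a = id" "std_b' \<circ> std_b = id" "std_a \<circ> std_b = std_b \<circ> std_a"
  "std_r \<circ> std_a = std_b \<circ> std_r" "std_r \<circ> std_b = std_a' \<circ> std_r"
  "std_s \<circ> std_a = std_a \<circ> std_s" "std_s \<circ> std_b = std_b' \<circ> std_s"
  by (rule W5_eqI; simp add: W5_comp W5_id)+

lemma std_distinct: "distinct [std_a, std_b, std_a', std_b']"
proof -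
  have "f 1 \<noteq> g 1 \<or> f 3 \<noteq> g 3 \<Longrightarrow> f \<noteq> g" for f g :: "int \<Rightarrow> int" by blast
  from this[of std_a std_b] this[of std_a std_a'] this[of std_a std_b'] this[of std_b std_a']
    this[of std_b std_b'] this[of std_a' std_b']
  show ?thesis by simp
qed

lemma one_to_five_cases:
  assumes "\<bar>t\<bar> \<in> {1..int 5}"
  obtains "t = 1" | "t = 2" | "t = 3" | "t = 4" | "t = 5"
    | "t = -1" | "t = -2" | "t = -3" | "t = -4" | "t = -5"
proof -
  have "t = 1 \<or> t = 2 \<or> t = 3 \<or> t = 4 \<or> t = 5 \<or> t = -1 \<or> t = -2 \<or> t = -3 \<or> t = -4 \<or> t = -5"
    using assms by auto
  then show ?thesis using that by blast
qed

lemma std_square_eq_minus: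
  assumes "\<bar>t\<bar> \<in> {1..int 5}"
  shows "std_a (std_a t) = - t \<Longrightarrow> t \<in> {1, -1, 2, -2}"
    and "std_b (std_b t) = - t \<Longrightarrow> t \<in> {3, -3, 4, -4}"
  using assms by (cases rule: one_to_five_cases; simp)+

text \<open>Commuting with the square of a quarter turn forces \<open>z\<close> to preserve the
  plane that this square negates. The second value in each plane follows from the first by commuting
  with the turn itself.\<close>

lemma std_centralizer_values:
  assumes z: "z \<in> W5" and za: "\<And>t. z (std_a t) = std_a (z t)" and zb: "\<And>t. z (std_b t) = std_b (z t)"
  shows "z 1 \<in> {1, -1, 2, -2}" "z 2 = std_a (z 1)" "z 3 \<in> {3, -3, 4, -4}" "z 4 = std_b (z 3)"
proof -
  have abs: "\<bar>z i\<bar> \<in> {1..int 5}" if "\<bar>i\<bar> \<in> {1..int 5}" for i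
    using that signed_perm_abs_in[OF carrier_weyl_D_signed_perm[OF z]] by blast
  show z2: "z 2 = std_a (z 1)" using za[of 1] by simp
  show z4: "z 4 = std_b (z 3)" using zb[of 3] by simp
  show "z 1 \<in> {1, -1, 2, -2}"
    using za[of 2] z2 W5_minus[OF z] by (intro std_square_eq_minus abs) simp_all
  show "z 3 \<in> {3, -3, 4, -4}"
    using zb[of 4] z4 W5_minus[OF z] by (intro std_square_eq_minus abs) simp_all
qed

text \<open>In each plane \<open>z\<close> acts as a power of the quarter turn. Fixing a coordinate
  makes it trivial in that plane, and the nontrivial square makes it a quarter turn in the other
  one.\<close>

lemma std_fixing_two:
  assumes z: "z \<in> W5" and za: "\<And>t. z (std_a t) = std_a (z t)" and zb: "\<And>t. z (std_b t) = std_b (z t)"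
    and zz: "z \<circ> z \<noteq> id"
    and u: "z u = u" "\<bar>u\<bar> \<in> {1..int 5}" and w: "z w = w" "\<bar>w\<bar> \<in> {1..int 5}" and uw: "\<bar>u\<bar> \<noteq> \<bar>w\<bar>"
  shows "z \<in> {std_a, std_b, std_a', std_b'}"
proof -
  note v = std_centralizer_values[OF z za zb]
  have fix_cases: "t = 5 \<or> t = -5 \<or> z 1 = 1 \<or> z 2 = 2 \<or> z 3 = 3 \<or> z 4 = 4" if "z t = t" "\<bar>t\<bar> \<in> {1..int 5}" for t
    using that(2) that(1) W5_minus[OF z] by (cases rule: one_to_five_cases) auto
  \<comment> \<open>Having different absolute values, \<open>u\<close> and \<open>w\<close> are not
    both 5 or -5, so one of them lies in a plane.\<close>
  have fixes': "z 1 = 1 \<or> z 2 = 2 \<or> z 3 = 3 \<or> z 4 = 4"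
    using fix_cases[OF u] fix_cases[OF w] uw by auto
  have no: "\<not> (z (z 1) = 1 \<and> z (z 2) = 2 \<and> z (z 3) = 3 \<and> z (z 4) = 4)"
  proof
    assume "z (z 1) = 1 \<and> z (z 2) = 2 \<and> z (z 3) = 3 \<and> z (z 4) = 4"
    then have "z \<circ> z = id" by (intro W5_eqI) (simp_all add: W5_comp W5_id z)
    with zz show False by simp
  qed
  consider "z 1 = 1" "z 2 = 2" "z 3 = 4" "z 4 = -3" | "z 1 = 1" "z 2 = 2" "z 3 = -4" "z 4 = 3"
    | "z 1 = 2" "z 2 = -1" "z 3 = 3" "z 4 = 4" | "z 1 = -2" "z 2 = 1" "z 3 = 3" "z 4 = 4"
    using v fixes' no W5_minus[OF z] by auto
  then show ?thesis
  proof cases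
    case 1 then have "z = std_b" by (intro W5_eqI) (simp_all add: z)
    then show ?thesis by simp
  next
    case 2 then have "z = std_b'" by (intro W5_eqI) (simp_all add: z)
    then show ?thesis by simp
  next
    case 3 then have "z = std_a" by (intro W5_eqI) (simp_all add: z)
    then show ?thesis by simp
  next
    case 4 then have "z = std_a'" by (intro W5_eqI) (simp_all add: z)
    then show ?thesis by simp
  qed
qed

text \<open>A nontrivial square and two fixed coordinates survive conjugation: \<open>h\<close>
  carries the fixed \<open>u\<close> and \<open>w\<close> of \<open>z0\<close> to fixed points of
  \<open>z\<close>. So \<open>std_fixing_two\<close> recognises the conjugate inside the
  centralizer.\<close>

lemma std_conj:
  assumes h: "h \<in> W5" and z0: "z0 \<in> {std_a, std_b, std_a', std_b'}"
    and z: "z \<in> W5" "z \<circ> h = h \<circ> z0" and za: "z \<circ> std_a = std_a \<circ> z" and zb: "z \<circ> std_b = std_b \<circ> z"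
  shows "z \<in> {std_a, std_b, std_a', std_b'}"
proof -
  note sh = carrier_weyl_D_signed_perm[OF h]
  have zh: "z (h t) = h (z0 t)" for t using fun_cong[OF z(2), of t] by simp
  obtain u w where uw: "z0 u = u" "z0 w = w" "\<bar>u\<bar> \<in> {1..int 5}" "\<bar>w\<bar> \<in> {1..int 5}" "\<bar>u\<bar> \<noteq> \<bar>w\<bar>"
  proof -
    have "z0 1 = 1 \<and> z0 2 = 2 \<or> z0 3 = 3 \<and> z0 4 = 4" using z0 by auto
    then show ?thesis using that[of 1 2] that[of 3 4] by auto
  qed
  have "z \<circ> z \<noteq> id"
  proof
    assume "z \<circ> z = id"
    then have "h (z0 (z0 t)) = h t" for t using zh by (metis comp_apply id_apply)
    then have "z0 (z0 t) = t" for t using signed_perm_eq_iff[OF sh] by blast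
    from this[of 1] this[of 3] show False using z0 by auto
  qed
  then show ?thesis
    using fun_cong[OF za] fun_cong[OF zb] z(1) zh uw signed_perm_abs_in[OF sh] signed_perm_abs_eq_iff[OF sh]
    by (intro std_fixing_two[of z "h u" "h w"]) simp_all
qed

lemma weyl_D5_Z4_times_Z4:
  obtains K where "abelian_subgroup (weyl_D 5) K" "Z4_factor_count (weyl_D 5) K 2" "card K = 16"
proof -
  interpret group "weyl_D 5" by (rule group_weyl_D)
  have pow: "p [^]\<^bsub>weyl_D 5\<^esub> (1::int) = p" "p [^]\<^bsub>weyl_D 5\<^esub> (2::int) = p \<circ> p"
    "p [^]\<^bsub>weyl_D 5\<^esub> (3::int) = p \<circ> p \<circ> p" "p [^]\<^bsub>weyl_D 5\<^esub> (4::int) = p \<circ> p \<circ> p \<circ> p" if "p \<in> W5" for p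
    using that int_pow_1[of p] int_pow_int[of "weyl_D 5" p "Suc (Suc 0)"]
      int_pow_int[of "weyl_D 5" p "Suc (Suc (Suc 0))"] int_pow_int[of "weyl_D 5" p "Suc (Suc (Suc (Suc 0)))"]
    by (simp_all add: comp_assoc)
  have four: "std_a \<circ> std_a \<circ> std_a \<circ> std_a = id" "std_b \<circ> std_b \<circ> std_b \<circ> std_b = id"
    by (rule W5_eqI; simp add: W5_comp W5_id)+
  have triv: "i = 0 \<and> j = 0" if ij: "i \<in> {0..<4}" "j \<in> {0..<4}"
    and "std_a [^]\<^bsub>weyl_D 5\<^esub> i \<otimes>\<^bsub>weyl_D 5\<^esub> std_b [^]\<^bsub>weyl_D 5\<^esub> j = \<one>\<^bsub>weyl_D 5\<^esub>" for i j :: int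
  proof -
    have eq: "(std_a [^]\<^bsub>weyl_D 5\<^esub> i) ((std_b [^]\<^bsub>weyl_D 5\<^esub> j) t) = t" for t
      using fun_cong[OF that(3), of t] by simp
    have "i = 0 \<or> i = 1 \<or> i = 2 \<or> i = 3" "j = 0 \<or> j = 1 \<or> j = 2 \<or> j = 3" using ij by auto
    \<comment> \<open>The two turns act in different planes, so the value at 1 detects
      \<open>i\<close> and the value at 3 detects \<open>j\<close>.\<close>
    then show ?thesis using eq[of 1] eq[of 3] by (elim disjE) (simp_all add: pow)
  qed
  show thesis
    by (rule Z4_times_Z4[of std_a std_b, OF _ _ _ _ _ triv that]) (simp_all add: pow std_relations four)
qed

section \<open>Reduction of an arbitrary torus to the standard one\<close>

lemma weyl_D5_centralizer_quotient:
  assumes g: "g \<in> W5" and a: "a \<in> W5" "a \<circ> g = g \<circ> std_a" and b: "b \<in> W5" "b \<circ> g = g \<circ> std_b"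
    and M: "M = {p \<in> W5. p \<circ> a = a \<circ> p \<and> p \<circ> b = b \<circ> p}"
  shows "discrete_weyl_group (weyl_D 5) M \<cong> dihedral8"
proof -
  interpret group "weyl_D 5" by (rule group_weyl_D)
  have inv: "inv\<^bsub>weyl_D 5\<^esub> std_a = std_a'" "inv\<^bsub>weyl_D 5\<^esub> std_b = std_b'"
    by (rule inv_equality; simp add: std_relations)+
  show ?thesis
  proof (rule normalizer_quotient_dihedral8_conj[of std_a std_b std_r std_s g a b])
    fix h z
    let ?z = "h \<otimes>\<^bsub>weyl_D 5\<^esub> z \<otimes>\<^bsub>weyl_D 5\<^esub> inv\<^bsub>weyl_D 5\<^esub> h"
    assume h: "h \<in> W5" and z: "z \<in> {std_a, std_b, inv\<^bsub>weyl_D 5\<^esub> std_a, inv\<^bsub>weyl_D 5\<^esub> std_b}"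
      and comm: "?z \<otimes>\<^bsub>weyl_D 5\<^esub> std_a = std_a \<otimes>\<^bsub>weyl_D 5\<^esub> ?z" "?z \<otimes>\<^bsub>weyl_D 5\<^esub> std_b = std_b \<otimes>\<^bsub>weyl_D 5\<^esub> ?z"
    have zW: "z \<in> W5" using z inv by auto
    then have "?z \<in> W5" using h by (intro m_closed inv_closed)
    moreover have "?z \<otimes>\<^bsub>weyl_D 5\<^esub> h = h \<otimes>\<^bsub>weyl_D 5\<^esub> z"
      using h zW by (simp only: m_assoc m_closed inv_closed l_inv r_one)
    ultimately have "?z \<in> {std_a, std_b, std_a', std_b'}"
      using std_conj[OF h, of z ?z] comm z by (simp only: inv mult_weyl_D)
    then show "?z \<in> {std_a, std_b, inv\<^bsub>weyl_D 5\<^esub> std_a, inv\<^bsub>weyl_D 5\<^esub> std_b}" by (simp only: inv)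
  qed (use assms std_distinct in \<open>simp_all add: inv std_relations\<close>)
qed

text \<open>Order 16 is the equality case of the bound, so there are two orbits of size 2 with
  quarter turns \<open>f\<close> and \<open>h\<close>. A signed permutation \<open>g\<close> carries
  the standard planes to these orbits, and counting shows that \<open>M\<close> contains both
  conjugated standard turns and is their full centralizer.\<close>

lemma weyl_D5_torus_quotient:
  assumes M: "abelian_subgroup (weyl_D 5) M" and card: "card M = 16"
    and p: "p \<in> M" and q: "q \<in> M" and sq: "p \<circ> p \<noteq> id" "q \<circ> q \<noteq> id" "p \<circ> p \<noteq> q \<circ> q"
  shows "discrete_weyl_group (weyl_D 5) M \<cong> dihedral8"
proof -
  interpret M: abelian_weyl_D 5 M by unfold_locales (rule M)
  have le: "\<forall>B\<in>M.orbs. card B \<le> 2"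
    using M.card_orb_le_2 card by simp
  obtain f h x y where f: "f \<in> M" "f (f x) = - x" "x \<noteq> 0" and h: "h \<in> M" "h (h y) = - y" "y \<noteq> 0"
    and xy: "\<bar>y\<bar> \<notin> M.orb x"
    using M.rotated_in_distinct_orbits[OF le p q sq] by metis
  define x' where "x' = f x"
  define y' where "y' = h y"
  note ox = M.orb_pairI[OF le f, folded x'_def] and oy = M.orb_pairI[OF le h, folded y'_def]
  have "\<bar>x\<bar> \<notin> M.orb y" "\<bar>x'\<bar> \<notin> M.orb y"
    using xy M.orb_eq[of _ y] M.orb_eq[of _ x] ox(4) oy(4) M.orb_self[of y] by auto
  then have dist: "distinct [\<bar>x\<bar>, \<bar>x'\<bar>, \<bar>y\<bar>, \<bar>y'\<bar>]"
    using ox(3) oy(3,4) by auto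
  define F where "F = {\<bar>x\<bar>, \<bar>x'\<bar>, \<bar>y\<bar>, \<bar>y'\<bar>}"
  have "F \<subseteq> {1..int 5}" using ox oy by (simp add: F_def)
  moreover have "card F = 4" using dist by (simp add: F_def)
  ultimately have "card ({1..int 5} - F) = 1" by (subst card_Diff_subset) (auto simp: F_def)
  \<comment> \<open>\<open>k\<close> is the coordinate left over by the two orbits; by
    \<open>weyl_D_eqI\<close> the value there is forced by the other four.\<close>
  then obtain k where k: "{1..int 5} - F = {k}" by (rule card_1_singletonE)
  then have kI: "k \<in> {1..int 5}" "k \<notin> F" by blast+
  have agree: "c = d" if c: "c \<in> W5" and d: "d \<in> W5"
    and eq: "c x = d x" "c x' = d x'" "c y = d y" "c y' = d y'" for c d
  proof (rule weyl_D_eqI[OF c d, of k])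
    fix i assume "i \<in> {1..int 5}" "i \<noteq> k"
    then have "i \<in> F" using k by blast
    then show "c i = d i"
      using eq W5_minus[OF c] W5_minus[OF d] by (auto simp: F_def abs_if)
  qed

  \<comment> \<open>The sign of the image of 5 is chosen so that \<open>g\<close> has an even number
    of sign changes.\<close>
  obtain e where e: "e = k \<or> e = - k" "even (length (filter (\<lambda>t. t < 0) [x, x', y, y', e]))"
  proof (cases "even (length (filter (\<lambda>t. t < 0) [x, x', y, y', k]))")
    case False
    then have "even (length (filter (\<lambda>t. t < 0) [x, x', y, y', - k]))"
      using kI(1) by (auto split: if_splits)
    then show thesis using that by blast
  qed (use that in blast)
  define g where "g = signed_list [x, x', y, y', e]"
  have abs_e: "\<bar>e\<bar> = k" using e(1) kI(1) by auto
  have g: "g \<in> W5"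
    unfolding g_def
  proof (rule signed_list_in_weyl_D)
    have "k \<noteq> \<bar>x\<bar>" "k \<noteq> \<bar>x'\<bar>" "k \<noteq> \<bar>y\<bar>" "k \<noteq> \<bar>y'\<bar>"
      using kI(2) unfolding F_def by blast+
    then show "distinct (map abs [x, x', y, y', e])"
      using dist abs_e by simp
    have "abs ` set [x, x', y, y', e] = {\<bar>x\<bar>, \<bar>x'\<bar>, \<bar>y\<bar>, \<bar>y'\<bar>, k}" using abs_e by simp
    then show "abs ` set [x, x', y, y', e] \<subseteq> {1..int 5}"
      using ox(1,2) oy(1,2) kI(1) by (simp only: insert_subset empty_subsetI simp_thms)
  qed (use e(2) in simp_all)
  have g_simps: "g 1 = x" "g 2 = x'" "g 3 = y" "g 4 = y'" "g (-1) = - x" "g (-3) = - y"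
    by (simp_all add: g_def signed_list_def)
  note sg = carrier_weyl_D_signed_perm[OF g]
  have g_surj: "\<exists>t. g t = z" for z by (rule signed_perm_ex[OF sg])

  define U where "U = {x, - x, x', - x'}"
  define V where "V = {y, - y, y', - y'}"
  \<comment> \<open>An element of \<open>M\<close> is determined by its values at \<open>x\<close>
    and \<open>y\<close>, for which there are at most \<open>4 * 4\<close> choices. Since
    \<open>M\<close> has 16 elements, every choice occurs.\<close>
  have hit: "\<exists>m\<in>M. m x = u \<and> m y = v" if "u \<in> U" "v \<in> V" for u v
  proof -
    have "inj_on (\<lambda>m. (m x, m y)) M"
    proof (rule inj_onI)
      fix c d assume cd: "c \<in> M" "d \<in> M" "(c x, c y) = (d x, d y)"
      then show "c = d"
        using M.agree_on_orb[OF cd(1,2), of x x'] M.agree_on_orb[OF cd(1,2), of y y'] ox(4) oy(4)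
        by (intro agree M.K_carrier) simp_all
    qed
    moreover have "(\<lambda>m. (m x, m y)) ` M \<subseteq> U \<times> V"
    proof (rule image_subsetI)
      fix m assume "m \<in> M"
      then have "\<bar>m x\<bar> \<in> M.orb x" "\<bar>m y\<bar> \<in> M.orb y" by (simp_all add: M.orb_def)
      then show "(m x, m y) \<in> U \<times> V" unfolding ox(4) oy(4) U_def V_def by (auto simp: abs_eq_iff)
    qed
    moreover have "card (U \<times> V) \<le> 16"
    proof -
      have "card U \<le> 4" "card V \<le> 4" unfolding U_def V_def by (auto intro!: card_insert_le_m1)
      then have "card U * card V \<le> 4 * 4" by (rule mult_le_mono)
      then show ?thesis by (simp add: card_cartesian_product)
    qed
    ultimately have "(\<lambda>m. (m x, m y)) ` M = U \<times> V"
      using card by (intro card_seteq) (simp_all add: U_def V_def card_image)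
    then have "(u, v) \<in> (\<lambda>m. (m x, m y)) ` M" using that by simp
    then show ?thesis by auto
  qed

  obtain a where a: "a \<in> M" "a x = x'" "a y = y" using hit[of x' y] by (auto simp: U_def V_def)
  obtain b where b: "b \<in> M" "b x = x" "b y = y'" using hit[of x y'] by (auto simp: U_def V_def)
  \<comment> \<open>\<open>a\<close> agrees with \<open>f\<close> on the orbit of \<open>x\<close>
    and with the identity on the orbit of \<open>y\<close>; \<open>b\<close> has the same relation
    to \<open>h\<close> with the orbits exchanged.\<close>
  have a': "a x' = - x" "a y' = y'"
    using M.agree_on_orb[OF a(1) f(1), of x x'] M.agree_on_orb[OF a(1) M.K_id, of y y'] a ox(4) oy(4) f(2)
    by (simp_all add: x'_def)
  have b': "b y' = - y" "b x' = x'"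
    using M.agree_on_orb[OF b(1) h(1), of y y'] M.agree_on_orb[OF b(1) M.K_id, of x x'] b ox(4) oy(4) h(2)
    by (simp_all add: y'_def)
  note aW = M.K_carrier[OF a(1)] and bW = M.K_carrier[OF b(1)]
  have ag: "a \<circ> g = g \<circ> std_a"
    by (rule W5_eqI) (simp_all add: W5_comp aW g g_simps a a')
  have bg: "b \<circ> g = g \<circ> std_b"
    by (rule W5_eqI) (simp_all add: W5_comp bW g g_simps b b')

  have "M = {c \<in> W5. c \<circ> a = a \<circ> c \<and> c \<circ> b = b \<circ> c}"
  proof (intro equalityI subsetI)
    fix c assume "c \<in> M"
    then show "c \<in> {c \<in> W5. c \<circ> a = a \<circ> c \<and> c \<circ> b = b \<circ> c}"
      using M.K_carrier M.K_commute a(1) b(1) by (auto simp: fun_eq_iff)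
  next
    fix c assume "c \<in> {c \<in> W5. c \<circ> a = a \<circ> c \<and> c \<circ> b = b \<circ> c}"
    then have c: "c \<in> W5" and ca: "c (a t) = a (c t)" and cb: "c (b t) = b (c t)" for t
      by (auto simp: fun_eq_iff)
    note sc = carrier_weyl_D_signed_perm[OF c]
    have ag': "a (g t) = g (std_a t)" and bg': "b (g t) = g (std_b t)" for t
      using fun_cong[OF ag, of t] fun_cong[OF bg, of t] by simp_all
    have cI: "\<bar>c i\<bar> \<in> {1..int 5}" if "\<bar>i\<bar> \<in> {1..int 5}" for i
      using that signed_perm_abs_in[OF sc] by blast
    \<comment> \<open>Pulled back along \<open>g\<close>, the condition that the square of
      \<open>a\<close> negates \<open>c x\<close> places it in the plane 1, 2, whose image under
      \<open>g\<close> is \<open>U\<close>.\<close>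
    have "c x \<in> U"
    proof -
      obtain t where t: "g t = c x" using g_surj by blast
      have "\<bar>t\<bar> \<in> {1..int 5}" using cI[OF ox(1)] signed_perm_abs_in[OF sg, of t] t by simp
      moreover have "a (a (c x)) = - c x"
        using ca[of x] ca[of x'] a(2) a'(1) W5_minus[OF c] by simp
      then have "g (std_a (std_a t)) = g (- t)"
        using t ag' W5_minus[OF g] by metis
      then have "std_a (std_a t) = - t" using signed_perm_eq_iff[OF sg] by blast
      ultimately have "t \<in> {1, -1, 2, -2}" by (rule std_square_eq_minus(1))
      then show ?thesis using t g_simps W5_minus[OF g] by (auto simp: U_def)
    qed
    moreover have "c y \<in> V"
    proof -
      obtain t where t: "g t = c y" using g_surj by blast
      have "\<bar>t\<bar> \<in> {1..int 5}" using cI[OF oy(1)] signed_perm_abs_in[OF sg, of t] t by simp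
      moreover have "b (b (c y)) = - c y"
        using cb[of y] cb[of y'] b(3) b'(1) W5_minus[OF c] by simp
      then have "g (std_b (std_b t)) = g (- t)"
        using t bg' W5_minus[OF g] by metis
      then have "std_b (std_b t) = - t" using signed_perm_eq_iff[OF sg] by blast
      ultimately have "t \<in> {3, -3, 4, -4}" by (rule std_square_eq_minus(2))
      then show ?thesis using t g_simps W5_minus[OF g] by (auto simp: V_def)
    qed
    \<comment> \<open>Some element of \<open>M\<close> has the same values as \<open>c\<close> at
      \<open>x\<close> and \<open>y\<close>. Commuting with \<open>a\<close> and \<open>b\<close>
      extends the agreement to \<open>x'\<close> and \<open>y'\<close>, hence \<open>c\<close> lies
      in \<open>M\<close>.\<close>
    ultimately obtain m where m: "m \<in> M" "m x = c x" "m y = c y" using hit by blast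
    have "c = m"
    proof (rule agree[OF c M.K_carrier[OF m(1)]])
      show "c x' = m x'" using ca[of x] M.K_commute[OF m(1) a(1), of x] a(2) m(2) by simp
      show "c y' = m y'" using cb[of y] M.K_commute[OF m(1) b(1), of y] b(3) m(3) by simp
    qed (simp_all add: m)
    with m(1) show "c \<in> M" by simp
  qed
  from weyl_D5_centralizer_quotient[OF g aW ag bW bg this] show ?thesis .
qed

theorem theorem4p2:
  fixes M :: "(int \<Rightarrow> int) set"
  assumes "discrete_maximal_torus (weyl_D 5) M"
  shows "discrete_weyl_group (weyl_D 5) M \<cong> dihedral8"
proof -
  obtain k where M: "abelian_subgroup (weyl_D 5) M"
    and max: "\<And>K. abelian_subgroup (weyl_D 5) K \<Longrightarrow> card K \<le> card M"
    and k: "Z4_factor_count (weyl_D 5) M k"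
    and k_max: "\<And>K k'. max_order_abelian (weyl_D 5) K \<Longrightarrow> Z4_factor_count (weyl_D 5) K k' \<Longrightarrow> k' \<le> k"
    using assms unfolding discrete_maximal_torus_def max_order_abelian_def by blast
  have bound: "card K \<le> 16" if "abelian_subgroup (weyl_D 5) K" for K
  proof -
    interpret abelian_weyl_D 5 K by unfold_locales (rule that)
    show ?thesis using card_le_power2 by simp
  qed
  obtain K where K: "abelian_subgroup (weyl_D 5) K" "Z4_factor_count (weyl_D 5) K 2" "card K = 16"
    by (rule weyl_D5_Z4_times_Z4)
  have "card M = 16" using max[OF K(1)] K(3) bound[OF M] by simp
  \<comment> \<open>\<open>K\<close> attains the maximal order 16, so it competes in the count of
    factors of order 4 and \<open>k\<close> is at least its count 2.\<close>
  moreover have "2 \<le> k"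
    using k_max[OF _ K(2)] K bound by (simp add: max_order_abelian_def)
  then obtain p q where "p \<in> M" "q \<in> M" "p \<circ> p \<noteq> id" "q \<circ> q \<noteq> id" "p \<circ> p \<noteq> q \<circ> q"
    using Z4_factor_count_2_imp_squares[OF group_weyl_D _ k] M
    by (simp add: abelian_subgroup_def) metis
  ultimately show ?thesis using weyl_D5_torus_quotient[OF M] by blast
qed

end
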